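(* Let $X_1, X_2, \ldots$ be i.i.d. real random variables and let $f_1, \ldots, f_m : \mathbb R \to \mathbb R$ be measurable functions with $\mathcal K(f_i) = \mathbb E[f_i^4(X)] < \infty$ and $s(f_i) > 0$ for $i = 1, \ldots, m$. Fix an integer $K \ge 1$. Then, as $N \to \infty$, $$ N^{1/2}\left[\hat{\mathbb C}_1, \ldots, \hat{\mathbb C}_K\right] \Rightarrow (\tilde\Xi_1, \ldots, \tilde\Xi_K), $$ where $\tilde\Xi_1, \ldots, \tilde\Xi_K$ are i.i.d. $\mathcal N_{m^2}(\mathbf 0, \mathbf C)$ random vectors and $$ \mathbf C_{(ij),(i'j')} = C(f_i, f_{i'})\,C(f_j, f_{j'}),\quad i,j,i',j' = 1, \ldots, m, $$ i.e. $\mathbf C = \mathcal C \otimes \mathcal C$.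
   Context: Let $X_1, X_2, \ldots$ be i.i.d. real random variables and $X$ a random variable with the same law as $X_1$. For measurable $f : \mathbb R \to \mathbb R$ write $m(f) = \mathbb E[f(X)]$, $Q(f) = \mathrm{Var}(f(X))$, $s(f) = Q(f)^{1/2}$, $\mathcal K(f) = \mathbb E[f^4(X)]$, and for two functions $Q(f,g) = \mathrm{Cov}(f(X), g(X))$, $C(f,g) = Q(f,g)/(s(f)s(g))$. For a sample size $N$ define $\hat m(f) = \frac1N\sum_{k=1}^N f(X_k)$, $\hat s^2(f) = \frac1N\sum_{i=1}^N (f(X_i) - \hat m(f))^2$, and for a lag $0 \le k < N$, $\hat\gamma_k(f,g) = \frac{1}{N-k}\sum_{i=1}^{N-k}(f(X_i) - \hat m(f))(g(X_{i+k}) - \hat m(g))$ and $\hat\rho_k(f,g) = \hat\gamma_k(f,g)/(\hat s(f)\hat s(g))$ (assigned an arbitrary value, say $0$, when a denominator vanishes); for $k = 0$ the subscript is omitted. For functions $f_1, \ldots, f_m$, set $\hat{\mathbb Q}_k = [\hat\gamma_k(f_i, f_j)]_{i,j=1,\ldots,m} \in \mathbb R^{m^2}$ and $\hat{\mathbb C}_k = [\hat\rho_k(f_i, f_j)]_{i,j=1,\ldots,m} \in \mathbb R^{m^2}$, with coordinates indexed by pairs $(i,j)$ in lexicographic order; $[\hat{\mathbb C}_1, \ldots, \hat{\mathbb C}_K] \in \mathbb R^{m^2K}$ denotes concatenation. Let $\mathcal Q = (Q(f_i,f_j))_{i,j=1}^m$ and $\mathcal C = (C(f_i,f_j))_{i,j=1}^m$.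 $\otimes$ is the Kronecker product, so $(A \otimes B)_{(ij),(i'j')} = A_{ii'}B_{jj'}$. $\Rightarrow$ denotes convergence in distribution as $N \to \infty$. *)

theory Defs
  imports "HOL-Probability.Probability"
begin

definition hat_m :: "nat \<Rightarrow> (real \<Rightarrow> real) \<Rightarrow> (nat \<Rightarrow> real) \<Rightarrow> real" where
  "hat_m N f x = (1 / real N) * (\<Sum>k=1..N. f (x k))"

definition hat_s2 :: "nat \<Rightarrow> (real \<Rightarrow> real) \<Rightarrow> (nat \<Rightarrow> real) \<Rightarrow> real" where
  "hat_s2 N f x = (1 / real N) * (\<Sum>i=1..N. (f (x i) - hat_m N f x)^2)"

definition hat_s :: "nat \<Rightarrow> (real \<Rightarrow> real) \<Rightarrow> (nat \<Rightarrow> real) \<Rightarrow> real" where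
  "hat_s N f x = sqrt (hat_s2 N f x)"

definition hat_gamma :: "nat \<Rightarrow> nat \<Rightarrow> (real \<Rightarrow> real) \<Rightarrow> (real \<Rightarrow> real) \<Rightarrow> (nat \<Rightarrow> real) \<Rightarrow> real" where
  "hat_gamma N k f g x =
     (1 / (real N - real k)) * (\<Sum>i=1..N-k. (f (x i) - hat_m N f x) * (g (x (i+k)) - hat_m N g x))"

definition hat_rho :: "nat \<Rightarrow> nat \<Rightarrow> (real \<Rightarrow> real) \<Rightarrow> (real \<Rightarrow> real) \<Rightarrow> (nat \<Rightarrow> real) \<Rightarrow> real" where
  "hat_rho N k f g x =
     (if hat_s N f x * hat_s N g x = 0 then 0
      else hat_gamma N k f g x / (hat_s N f x * hat_s N g x))"

definition pop_mean :: "'a measure \<Rightarrow> ('a \<Rightarrow> real) \<Rightarrow> (real \<Rightarrow> real) \<Rightarrow> real" where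
  "pop_mean M Z f = (\<integral>\<omega>. f (Z \<omega>) \<partial>M)"

definition pop_cov :: "'a measure \<Rightarrow> ('a \<Rightarrow> real) \<Rightarrow> (real \<Rightarrow> real) \<Rightarrow> (real \<Rightarrow> real) \<Rightarrow> real" where
  "pop_cov M Z f g = (\<integral>\<omega>. (f (Z \<omega>) - pop_mean M Z f) * (g (Z \<omega>) - pop_mean M Z g) \<partial>M)"

definition pop_corr :: "'a measure \<Rightarrow> ('a \<Rightarrow> real) \<Rightarrow> (real \<Rightarrow> real) \<Rightarrow> (real \<Rightarrow> real) \<Rightarrow> real" where
  "pop_corr M Z f g = pop_cov M Z f g / (sqrt (pop_cov M Z f f) * sqrt (pop_cov M Z g g))"

definition conv_distr :: "'a measure \<Rightarrow> (nat \<Rightarrow> 'a \<Rightarrow> 'b::topological_space) \<Rightarrow> 'b measure \<Rightarrow> bool" where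
  "conv_distr M Y L \<longleftrightarrow>
     (\<forall>g::'b \<Rightarrow> real. continuous_on UNIV g \<and> bounded (range g) \<longrightarrow>
        (\<lambda>N. \<integral>\<omega>. g (Y N \<omega>) \<partial>M) \<longlonglongrightarrow> (\<integral>x. g x \<partial>L))"

text \<open>Centered (possibly degenerate) multivariate normal law N(0, S) for vectors indexed by
  the finite set I (coordinates outside I are 0), defined by its characteristic function.\<close>
definition centered_gaussian :: "('i \<Rightarrow> real) measure \<Rightarrow> 'i set \<Rightarrow> ('i \<Rightarrow> 'i \<Rightarrow> real) \<Rightarrow> bool" where
  "centered_gaussian \<mu> I S \<longleftrightarrow>
     prob_space \<mu> \<and> sets \<mu> = sets borel \<and>
     (AE x in \<mu>. \<forall>p. p \<notin> I \<longrightarrow> x p = 0) \<and>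
     (\<forall>t::'i \<Rightarrow> real. (\<integral>x. cis (\<Sum>p\<in>I. t p * x p) \<partial>\<mu>)
          = complex_of_real (exp (- (\<Sum>p\<in>I. \<Sum>q\<in>I. t p * S p q * t q) / 2)))"

end

(* The statistic is invariant under affine changes of the f_i, so they may be replaced by standardized
   functions a_i. Removing the sample means and the sample variances is then asymptotically negligible
   (Slutsky), and N^(1/2) times the lag k sample correlation of f_i and f_j becomes
   N^(-1/2) sum_n a_i(X_n) a_j(X_(n+k)). For lags k >= 1 these products are centered, and two of them
   with different n or different k are uncorrelated because some X_l occurs in one factor only; this
   yields independence over the lags and the covariance C (x) C in the limit. A linear combination of
   the sums is a normalized sum of a K-dependent orthogonal stationary sequence: grouping it into
   blocks of length p separated by gaps of length K gives i.i.d. block sums, whose normalization differs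
   from that of the full sum by an L2 error that vanishes as p grows. The Cramer-Wold device passes from
   linear combinations to the joint law. *)

theory Submission
  imports Defs
begin

section \<open>Convergence in distribution from characteristic functions\<close>

text \<open>The vectors are functions on a countable index type, supported on a finite set, and the
  continuity theorem for their laws is proved by hand: Stone-Weierstrass handles large cubes and
  tightness the rest. Tightness is not extracted from the characteristic functions, because bounded
  second moments of the lag sums supply it directly. The matrix C (x) C may be singular, so no
  density is available. The limit law is fixed by its characteristic function and built as a linear
  image of independent standard normals; positive semidefiniteness follows because the matrix is the
  covariance of the lag 1 products. The sums for lag k run over all n < N and thus read k
  observations beyond the sample. All lags then share one index range, and a linear combination over
  lags is a sum along a single sequence. Nearly every error term is a weighted sum of orthogonal
  variables, whose variance is v times the sum of the squared weights. This one formula settles the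
  sample means, the truncation at N - k and the gaps between blocks. The fourth moments give a_i^2 a
  finite variance, so that the sample variances are consistent by Chebyshev.\<close>

inductive trig_poly :: "'i set \<Rightarrow> (('i \<Rightarrow> real) \<Rightarrow> complex) \<Rightarrow> bool" for D where
  trig_poly_cis: "trig_poly D (\<lambda>x. a * cis (\<Sum>p\<in>D. t p * x p))"
| trig_poly_add: "trig_poly D f \<Longrightarrow> trig_poly D g \<Longrightarrow> trig_poly D (\<lambda>x. f x + g x)"

text \<open>Frequencies add when characters are multiplied, and products distribute over both sums,
  hence the nested induction. This gives the algebra required by Stone-Weierstrass.\<close>

lemma trig_poly_mult:
  assumes "trig_poly D f" "trig_poly D g"
  shows "trig_poly D (\<lambda>x. f x * g x)"
  using assms
proof (induction f)
  case (trig_poly_cis a t)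
  from \<open>trig_poly D g\<close> show ?case
  proof (induction g)
    case (trig_poly_cis b s)
    have "trig_poly D (\<lambda>x. (a * b) * cis (\<Sum>p\<in>D. (t p + s p) * x p))"
      by (rule trig_poly.trig_poly_cis)
    then show ?case
      by (simp add: cis_mult sum.distrib distrib_right mult.assoc mult.left_commute[of "cis _"])
  next
    case (trig_poly_add f g)
    then show ?case by (auto simp: distrib_left dest: trig_poly.trig_poly_add)
  qed
next
  case (trig_poly_add f g)
  then show ?case by (auto simp: distrib_right dest: trig_poly.trig_poly_add)
qed

lemma trig_poly_const: "trig_poly D (\<lambda>_. a)"
  using trig_poly_cis[of D a "\<lambda>_. 0"] by simp

text \<open>Euler's formula with two opposite frequency vectors concentrated at \<open>p\<close>.
  These sines are the functions that separate points in the approximation.\<close>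

lemma trig_poly_sin:
  assumes "finite D" "p \<in> D"
  shows "trig_poly D (\<lambda>x. complex_of_real (sin (c * x p)))"
proof -
  define t where "t = (\<lambda>q. if q = p then c else 0)"
  have t: "(\<Sum>q\<in>D. t q * x q) = c * x p" "(\<Sum>q\<in>D. - t q * x q) = - (c * x p)" for x :: "'a \<Rightarrow> real"
    using assms by (auto simp: t_def if_distrib[where f="\<lambda>u. u * _"] sum_negf cong: if_cong)
  have "trig_poly D (\<lambda>x. (- \<i> / 2) * cis (\<Sum>q\<in>D. t q * x q) + (\<i> / 2) * cis (\<Sum>q\<in>D. - t q * x q))"
    by (intro trig_poly.intros)
  then show ?thesis
    unfolding t by (rule back_subst[of "trig_poly D"]) (simp add: complex_eq_iff fun_eq_iff)
qed

section \<open>Expectations of trigonometric polynomials and their density on cubes\<close>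

lemma (in prob_space) integrable_cis:
  assumes "h \<in> borel_measurable M"
  shows "integrable M (\<lambda>\<omega>. cis (h \<omega>))"
  unfolding cis_conv_exp using assms by (auto intro!: integrable_iexp)

text \<open>By linearity the limit only has to be known on single characters, which is
  \<open>char\<close>. Integrability is carried through the induction, since the integral of a sum
  may be split only for integrable summands.\<close>

lemma trig_poly_expectation_tendsto:
  fixes Y :: "nat \<Rightarrow> 'a \<Rightarrow> 'i::countable \<Rightarrow> real"
  assumes "prob_space M" "prob_space \<nu>" and sets: "sets \<nu> = sets borel"
    and Y: "\<And>N p. (\<lambda>\<omega>. Y N \<omega> p) \<in> borel_measurable M"
    and char: "\<And>t. (\<lambda>N. \<integral>\<omega>. cis (\<Sum>p\<in>D. t p * Y N \<omega> p) \<partial>M)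
        \<longlonglongrightarrow> (\<integral>x. cis (\<Sum>p\<in>D. t p * x p) \<partial>\<nu>)"
    and "trig_poly D f"
  shows "(\<lambda>N. \<integral>\<omega>. f (Y N \<omega>) \<partial>M) \<longlonglongrightarrow> (\<integral>x. f x \<partial>\<nu>)"
proof -
  interpret M: prob_space M by fact
  interpret N: prob_space \<nu> by fact
  note Y[measurable]
  have [measurable]: "(\<lambda>x. x p) \<in> borel_measurable \<nu>" for p
    unfolding measurable_cong_sets[OF sets refl] by measurable
  have "(\<forall>N. integrable M (\<lambda>\<omega>. f (Y N \<omega>))) \<and> integrable \<nu> f \<and>
     (\<lambda>N. \<integral>\<omega>. f (Y N \<omega>) \<partial>M) \<longlonglongrightarrow> (\<integral>x. f x \<partial>\<nu>)"
    using \<open>trig_poly D f\<close>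
  proof induction
    case (trig_poly_cis a t)
    then show ?case
      by (auto intro!: integrable_mult_right M.integrable_cis N.integrable_cis tendsto_mult char)
  next
    case (trig_poly_add f g)
    then show ?case by (auto intro: tendsto_add)
  qed
  then show ?thesis by simp
qed

text \<open>Tychonoff. Coordinates outside \<open>D\<close> are frozen at 0, so that two distinct
  points of the cube always differ at some coordinate in \<open>D\<close>.\<close>

lemma compact_cube:
  fixes D :: "'i::countable set"
  shows "compact {u :: 'i \<Rightarrow> real. \<forall>p. u p \<in> (if p \<in> D then {-1..1} else {0})}"
proof -
  have "compactin (product_topology (\<lambda>_. euclidean) UNIV)
     (Pi\<^sub>E UNIV (\<lambda>p. if p \<in> D then {-1..1::real} else {0}))"
    unfolding compactin_PiE by auto
  then show ?thesis
    by (simp add: euclidean_product_topology PiE_UNIV_domain Pi_def)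
qed

text \<open>A continuous function on a cube is pulled back to a function of the sines of the rescaled
  coordinates. A polynomial approximation in these sines is then a trigonometric polynomial
  whose sup norm is controlled on the whole space and not only on the cube.\<close>

lemma trig_poly_approximation:
  fixes g :: "('i::countable \<Rightarrow> real) \<Rightarrow> real" and D :: "'i set"
  assumes D: "finite D" and g: "continuous_on UNIV g" and B: "\<And>x. \<bar>g x\<bar> \<le> B"
    and "R > 0" "e > 0"
  obtains T where "trig_poly D (\<lambda>x. complex_of_real (T x))" "T \<in> borel_measurable borel"
    "\<And>x. \<bar>T x\<bar> \<le> B + e"
    "\<And>x. (\<And>p. p \<notin> D \<Longrightarrow> x p = 0) \<Longrightarrow> (\<And>p. p \<in> D \<Longrightarrow> \<bar>x p\<bar> \<le> R) \<Longrightarrow> \<bar>g x - T x\<bar> < e"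
proof -
  \<comment> \<open>This scale maps [-R, R] onto [-pi/2, pi/2], the range on which
    \<open>arcsin\<close> inverts the sine.\<close>
  define c where "c = pi / (2 * R)"
  have "c > 0" using \<open>R > 0\<close> by (simp add: c_def)
  define S where "S = {u :: 'i \<Rightarrow> real. \<forall>p. u p \<in> (if p \<in> D then {-1..1} else {0})}"
  define sn where "sn = (\<lambda>x::'i \<Rightarrow> real. \<lambda>p. if p \<in> D then sin (c * x p) else 0)"
  \<comment> \<open>\<open>G\<close> is \<open>g\<close> read in sine coordinates:
    \<open>G (sn x) = g x\<close> when x is supported on \<open>D\<close> with coordinates of size
    at most \<open>R\<close>.\<close>
  define G where "G = (\<lambda>u. g (\<lambda>p. if p \<in> D then arcsin (u p) / c else 0))"
  \<comment> \<open>The class contains the functions of the sine coordinates that become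
    trigonometric polynomials after composition with \<open>sn\<close>. Polynomials in finitely many
    coordinates belong to it.\<close>
  define P where "P = (\<lambda>h. continuous_on UNIV h \<and> trig_poly D (\<lambda>x. complex_of_real (h (sn x))))"
  have sn_S: "sn x \<in> S" for x
    by (auto simp: sn_def S_def)
  have cont_coord: "continuous_on A (\<lambda>u::'i \<Rightarrow> real. u p)" for A p
    by (rule continuous_on_subset[OF continuous_on_product_coordinates]) auto
  have "continuous_on S (\<lambda>u. \<lambda>p. if p \<in> D then arcsin (u p) / c else 0)"
  proof (rule continuous_on_coordinatewise_then_product)
    fix p
    show "continuous_on S (\<lambda>u. if p \<in> D then arcsin (u p) / c else 0)"
    proof (cases "p \<in> D")
      case True
      then have "\<forall>u\<in>S. - 1 \<le> u p \<and> u p \<le> 1"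
        by (auto simp: S_def dest!: spec[of _ p])
      then show ?thesis
        using True \<open>c > 0\<close> by (auto intro!: continuous_intros cont_coord)
    qed auto
  qed
  then have cont_G: "continuous_on S G"
    unfolding G_def by (rule continuous_on_compose2[OF g]) auto
  have "\<exists>h. P h \<and> (\<forall>u\<in>S. \<bar>G u - h u\<bar> < e)"
  proof (rule Stone_Weierstrass_HOL[of S P G e])
    show "compact S" unfolding S_def by (rule compact_cube)
    show "P (\<lambda>_. a)" for a by (auto simp: P_def trig_poly_const)
    show "P f \<Longrightarrow> continuous_on S f" for f by (auto simp: P_def intro: continuous_on_subset)
    show "P f \<and> P g \<Longrightarrow> P (\<lambda>x. f x + g x)" for f g
      by (auto simp: P_def intro: continuous_intros trig_poly_add)
    show "P f \<and> P g \<Longrightarrow> P (\<lambda>x. f x * g x)" for f g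
      by (auto simp: P_def intro: continuous_intros trig_poly_mult)
    show "\<exists>f. P f \<and> f x \<noteq> f y" if xy: "x \<in> S \<and> y \<in> S \<and> x \<noteq> y" for x y
    proof -
      obtain p where p: "x p \<noteq> y p" using xy by auto
      then have "p \<in> D"
        using xy by (cases "p \<in> D") (auto simp: S_def dest!: spec[of _ p])
      have "P (\<lambda>u. u p)"
        unfolding P_def using trig_poly_sin[OF D \<open>p \<in> D\<close>] \<open>p \<in> D\<close> by (auto simp: sn_def cont_coord)
      with p show ?thesis by blast
    qed
  qed (use cont_G \<open>e > 0\<close> in auto)
  then obtain h where h: "P h" "\<And>u. u \<in> S \<Longrightarrow> \<bar>G u - h u\<bar> < e" by blast
  show ?thesis
  proof
    show "trig_poly D (\<lambda>x. complex_of_real (h (sn x)))" using h(1) by (simp add: P_def)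
    have "continuous_on UNIV sn"
    proof (rule continuous_on_coordinatewise_then_product)
      show "continuous_on UNIV (\<lambda>x. sn x p)" for p
        unfolding sn_def by (cases "p \<in> D") (auto intro!: continuous_intros cont_coord)
    qed
    then have "continuous_on UNIV (\<lambda>x. h (sn x))"
      using h(1) by (auto simp: P_def intro: continuous_on_compose2[of UNIV h UNIV sn])
    then show "(\<lambda>x. h (sn x)) \<in> borel_measurable borel"
      by (rule borel_measurable_continuous_onI)
    \<comment> \<open>Every x is sent into \<open>S\<close> by \<open>sn\<close>, and every value of
      \<open>G\<close> is a value of \<open>g\<close>; the bound therefore does not require x to lie
      in the cube.\<close>
    show "\<bar>h (sn x)\<bar> \<le> B + e" for x
      using h(2)[OF sn_S[of x]] B[of "\<lambda>p. if p \<in> D then arcsin (sn x p) / c else 0"]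
      by (auto simp: G_def)
    show "\<bar>g x - h (sn x)\<bar> < e"
      if x: "\<And>p. p \<notin> D \<Longrightarrow> x p = 0" "\<And>p. p \<in> D \<Longrightarrow> \<bar>x p\<bar> \<le> R" for x
    proof -
      have "arcsin (sin (c * x p)) / c = x p" if "p \<in> D" for p
      proof -
        have "\<bar>c * x p\<bar> \<le> c * R"
          using x(2)[OF that] \<open>c > 0\<close> by (simp add: abs_mult)
        also have "c * R = pi / 2" using \<open>R > 0\<close> by (simp add: c_def)
        finally have "arcsin (sin (c * x p)) = c * x p"
          by (intro arcsin_sin) auto
        then show ?thesis using \<open>c > 0\<close> by simp
      qed
      then have "(\<lambda>p. if p \<in> D then arcsin (sn x p) / c else 0) = x"
        using x(1) by (auto simp: sn_def fun_eq_iff)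
      then have "G (sn x) = g x"
        by (simp add: G_def)
      then show ?thesis using h(2)[OF sn_S[of x]] by simp
    qed
  qed
qed

text \<open>Tightness of a sequence, O_P(1). The tail bound is only asked for large N, so sequences
  that tend to 0 in probability qualify without any control of their first members.\<close>

definition (in prob_space) bounded_in_prob :: "(nat \<Rightarrow> 'a \<Rightarrow> real) \<Rightarrow> bool" where
  "bounded_in_prob Y \<longleftrightarrow> (\<forall>N. random_variable borel (Y N)) \<and>
     (\<forall>e>0. \<exists>R. \<forall>\<^sub>F N in sequentially. prob {\<omega>\<in>space M. \<bar>Y N \<omega>\<bar> > R} < e)"

text \<open>Continuity from above along the decreasing tail events. Under the limit law this bounds
  the mass outside a large cube.\<close>

lemma (in prob_space) bounded_in_prob_const:
  assumes [measurable]: "random_variable borel h"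
  shows "bounded_in_prob (\<lambda>_. h)"
  unfolding bounded_in_prob_def
proof (intro conjI allI impI)
  fix e :: real assume "e > 0"
  have "(\<lambda>n. prob {\<omega>\<in>space M. \<bar>h \<omega>\<bar> > real n}) \<longlonglongrightarrow> prob (\<Inter>n. {\<omega>\<in>space M. \<bar>h \<omega>\<bar> > real n})"
    by (intro finite_Lim_measure_decseq) (auto simp: decseq_def)
  also have "(\<Inter>n. {\<omega>\<in>space M. \<bar>h \<omega>\<bar> > real n}) = {}"
    using reals_Archimedean2 by (auto dest: order.asym)
  finally have "\<forall>\<^sub>F n in sequentially. prob {\<omega>\<in>space M. \<bar>h \<omega>\<bar> > real n} < e"
    using \<open>e > 0\<close> by (auto dest: order_tendstoD(2))
  then obtain n where "prob {\<omega>\<in>space M. \<bar>h \<omega>\<bar> > real n} < e"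
    by (auto simp: eventually_sequentially)
  then show "\<exists>R. \<forall>\<^sub>F N in sequentially. prob {\<omega>\<in>space M. \<bar>h \<omega>\<bar> > R} < e" by auto
qed fact

text \<open>A union bound over the coordinates. The bound is asserted for all radii beyond
  \<open>R0\<close>, so that one radius can serve the sequence and the limit law together.\<close>

lemma (in prob_space) bounded_in_prob_finite:
  assumes "finite D" "\<And>p. p \<in> D \<Longrightarrow> bounded_in_prob (\<lambda>N \<omega>. Y N \<omega> p)" "e > 0"
  shows "\<exists>R0. \<forall>R\<ge>R0. \<forall>\<^sub>F N in sequentially. prob {\<omega>\<in>space M. \<exists>p\<in>D. \<bar>Y N \<omega> p\<bar> > R} < e"
  using assms
proof (induction D arbitrary: e rule: finite_induct)
  case (insert p D)
  obtain R1 where R1: "\<forall>\<^sub>F N in sequentially. prob {\<omega>\<in>space M. \<bar>Y N \<omega> p\<bar> > R1} < e / 2"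
    using insert.prems(1)[of p] \<open>e > 0\<close> unfolding bounded_in_prob_def by (meson half_gt_zero insertI1)
  obtain R2 where R2: "\<And>R. R \<ge> R2 \<Longrightarrow> \<forall>\<^sub>F N in sequentially. prob {\<omega>\<in>space M. \<exists>p\<in>D. \<bar>Y N \<omega> p\<bar> > R} < e / 2"
    using insert.IH[of "e / 2"] insert.prems by (meson half_gt_zero insertI2)
  have m[measurable]: "(\<lambda>\<omega>. Y N \<omega> q) \<in> borel_measurable M" if "q \<in> insert p D" for N q
    using insert.prems(1)[OF that] by (auto simp: bounded_in_prob_def)
  have sets: "{\<omega>\<in>space M. \<bar>Y N \<omega> p\<bar> > R} \<in> events" "{\<omega>\<in>space M. \<exists>p\<in>D. \<bar>Y N \<omega> p\<bar> > R} \<in> events" for N R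
    using insert.hyps by (auto intro!: measurable_sets sets.sets_Collect_finite_Ex borel_measurable_less borel_measurable_abs m)
  show ?case
  proof (intro exI[of _ "max R1 R2"] allI impI)
    fix R assume R: "R \<ge> max R1 R2"
    show "\<forall>\<^sub>F N in sequentially. prob {\<omega>\<in>space M. \<exists>p\<in>insert p D. \<bar>Y N \<omega> p\<bar> > R} < e"
      using R1 R2[OF order_trans[OF max.cobounded2 R]]
    proof eventually_elim
      case (elim N)
      have "prob {\<omega>\<in>space M. \<exists>p\<in>insert p D. \<bar>Y N \<omega> p\<bar> > R}
          \<le> prob ({\<omega>\<in>space M. \<bar>Y N \<omega> p\<bar> > R1} \<union> {\<omega>\<in>space M. \<exists>p\<in>D. \<bar>Y N \<omega> p\<bar> > R})"
        using R sets by (intro finite_measure_mono) auto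
      also have "\<dots> \<le> prob {\<omega>\<in>space M. \<bar>Y N \<omega> p\<bar> > R1} + prob {\<omega>\<in>space M. \<exists>p\<in>D. \<bar>Y N \<omega> p\<bar> > R}"
        by (intro measure_Un_le sets)
      also have "\<dots> < e" using elim R by auto
      finally show ?case .
    qed
  qed
qed auto

text \<open>Off \<open>A\<close> the integrands differ by at most \<open>e\<close>, on
  \<open>A\<close> by at most \<open>2 * B + e\<close>. Closeness is required almost everywhere
  only, because the limit law is supported on \<open>D\<close> merely almost surely.\<close>

lemma (in prob_space) expectation_approx_off_event:
  fixes Z :: "'a \<Rightarrow> real"
  assumes [measurable]: "random_variable borel Z" "random_variable borel W" "A \<in> events"
    and Z: "\<And>\<omega>. \<bar>Z \<omega>\<bar> \<le> B" and W: "\<And>\<omega>. \<bar>W \<omega>\<bar> \<le> B + e"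
    and e: "e \<ge> 0" and AE: "AE \<omega> in M. \<omega> \<notin> A \<longrightarrow> \<bar>Z \<omega> - W \<omega>\<bar> \<le> e"
  shows "\<bar>expectation Z - expectation W\<bar> \<le> e + (2 * B + e) * prob A"
proof -
  have int: "integrable M Z" "integrable M W"
    using integrable_const_bound[of Z B] integrable_const_bound[of W "B + e"] Z W by auto
  have intA: "integrable M (indicator A :: 'a \<Rightarrow> real)"
    by (rule integrable_const_bound[of _ 1]) (auto simp: indicator_def)
  have "\<bar>expectation Z - expectation W\<bar> = \<bar>expectation (\<lambda>\<omega>. Z \<omega> - W \<omega>)\<bar>"
    using int by simp
  also have "\<dots> \<le> expectation (\<lambda>\<omega>. \<bar>Z \<omega> - W \<omega>\<bar>)"
    by (rule integral_abs_bound)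
  also have "\<dots> \<le> expectation (\<lambda>\<omega>. e + (2 * B + e) * indicator A \<omega>)"
  proof (intro integral_mono_AE)
    show "AE \<omega> in M. \<bar>Z \<omega> - W \<omega>\<bar> \<le> e + (2 * B + e) * indicator A \<omega>"
      using AE
    proof eventually_elim
      case (elim \<omega>)
      show ?case using elim Z[of \<omega>] W[of \<omega>] e by (cases "\<omega> \<in> A") auto
    qed
  qed (use int intA in auto)
  also have "\<dots> = e + (2 * B + e) * prob A"
    using intA by (simp add: prob_space)
  finally show ?thesis .
qed

text \<open>A test function is replaced by one trigonometric polynomial, both under the sequence and
  under the limit law. The replacement is accurate on a cube that carries most of the mass of both,
  and costs at most a bounded factor outside it.\<close>

theorem (in prob_space) conv_distr_cramer_wold:
  fixes Y :: "nat \<Rightarrow> 'a \<Rightarrow> 'i::countable \<Rightarrow> real" and D :: "'i set"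
  assumes D: "finite D"
    and Y: "\<And>N p. (\<lambda>\<omega>. Y N \<omega> p) \<in> borel_measurable M"
    and Y_support: "\<And>N \<omega> p. p \<notin> D \<Longrightarrow> Y N \<omega> p = 0"
    and \<nu>: "prob_space \<nu>" "sets \<nu> = sets borel" "AE x in \<nu>. \<forall>p. p \<notin> D \<longrightarrow> x p = 0"
    and char: "\<And>t. (\<lambda>N. \<integral>\<omega>. cis (\<Sum>p\<in>D. t p * Y N \<omega> p) \<partial>M)
        \<longlonglongrightarrow> (\<integral>x. cis (\<Sum>p\<in>D. t p * x p) \<partial>\<nu>)"
    and bdd: "\<And>p. p \<in> D \<Longrightarrow> bounded_in_prob (\<lambda>N \<omega>. Y N \<omega> p)"
  shows "conv_distr M Y \<nu>"
  unfolding conv_distr_def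
proof (intro allI impI, elim conjE)
  fix g :: "('i \<Rightarrow> real) \<Rightarrow> real"
  assume g: "continuous_on UNIV g" and "bounded (range g)"
  then obtain B where B: "\<And>x. \<bar>g x\<bar> \<le> B" "B \<ge> 0"
    by (auto simp: bounded_pos) (metis less_le)
  interpret N: prob_space \<nu> by fact
  note Y[measurable]
  have m\<nu>[measurable]: "(\<lambda>x. x p) \<in> borel_measurable \<nu>" for p
    unfolding measurable_cong_sets[OF \<nu>(2) refl] by measurable
  have mY[measurable]: "Y N \<in> borel_measurable M" for N
    by (rule measurable_coordinatewise_then_product) simp
  have mg: "g \<in> borel_measurable borel" by (rule borel_measurable_continuous_onI) fact
  show "(\<lambda>N. \<integral>\<omega>. g (Y N \<omega>) \<partial>M) \<longlonglongrightarrow> (\<integral>x. g x \<partial>\<nu>)"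
    unfolding tendsto_iff dist_real_def
  proof (intro allI impI)
    fix r :: real assume "r > 0"
    \<comment> \<open>The total error is \<open>e\<close> for the polynomial plus twice
      \<open>e + (2 * B + 1) * e\<close> for the replacements, that is
      \<open>e * (4 * B + 5)\<close>; the 6 makes the inequality strict, and
      \<open>e \<le> 1\<close> turns \<open>2 * B + e\<close> into \<open>2 * B + 1\<close>.\<close>
    define e where "e = min 1 (r / (4 * B + 6))"
    have e: "e > 0" "e \<le> 1" "e * (4 * B + 5) < r"
    proof -
      show "e > 0" "e \<le> 1" using \<open>r > 0\<close> B by (auto simp: e_def)
      have "e * (4 * B + 5) < e * (4 * B + 6)" using \<open>e > 0\<close> by simp
      also have "\<dots> \<le> (r / (4 * B + 6)) * (4 * B + 6)"
        using B by (intro mult_right_mono) (auto simp: e_def)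
      also have "\<dots> = r" using B by simp
      finally show "e * (4 * B + 5) < r" by simp
    qed
    obtain R1 where R1: "\<And>R. R \<ge> R1 \<Longrightarrow> \<forall>\<^sub>F N in sequentially. prob {\<omega>\<in>space M. \<exists>p\<in>D. \<bar>Y N \<omega> p\<bar> > R} < e"
      using bounded_in_prob_finite[of D Y e, OF D bdd \<open>e > 0\<close>] by auto
    obtain R2 where R2: "\<And>R. R \<ge> R2 \<Longrightarrow> N.prob {x\<in>space \<nu>. \<exists>p\<in>D. \<bar>x p\<bar> > R} < e"
      using N.bounded_in_prob_finite[of D "\<lambda>_ x. x", OF D N.bounded_in_prob_const[OF m\<nu>] \<open>e > 0\<close>] by auto
    define R where "R = Max {1, R1, R2}"
    have R: "R > 0" "R \<ge> R1" "R \<ge> R2" by (auto simp: R_def)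
    obtain T where T: "trig_poly D (\<lambda>x. complex_of_real (T x))" "T \<in> borel_measurable borel"
      "\<And>x. \<bar>T x\<bar> \<le> B + e"
      "\<And>x. (\<And>p. p \<notin> D \<Longrightarrow> x p = 0) \<Longrightarrow> (\<And>p. p \<in> D \<Longrightarrow> \<bar>x p\<bar> \<le> R) \<Longrightarrow> \<bar>g x - T x\<bar> < e"
      using trig_poly_approximation[OF D g B(1) \<open>R > 0\<close> \<open>e > 0\<close>] by metis
    have "(\<lambda>N. \<integral>\<omega>. complex_of_real (T (Y N \<omega>)) \<partial>M) \<longlonglongrightarrow> (\<integral>x. complex_of_real (T x) \<partial>\<nu>)"
      by (rule trig_poly_expectation_tendsto[OF prob_space_axioms \<nu>(1,2) Y char T(1)])
    then have "(\<lambda>N. \<integral>\<omega>. T (Y N \<omega>) \<partial>M) \<longlonglongrightarrow> (\<integral>x. T x \<partial>\<nu>)"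
      unfolding integral_complex_of_real tendsto_of_real_iff .
    then have "\<forall>\<^sub>F N in sequentially. \<bar>(\<integral>\<omega>. T (Y N \<omega>) \<partial>M) - (\<integral>x. T x \<partial>\<nu>)\<bar> < e"
      using \<open>e > 0\<close> unfolding tendsto_iff dist_real_def by auto
    moreover note R1[OF R(2)]
    ultimately show "\<forall>\<^sub>F N in sequentially. \<bar>(\<integral>\<omega>. g (Y N \<omega>) \<partial>M) - (\<integral>x. g x \<partial>\<nu>)\<bar> < r"
    proof eventually_elim
      case (elim N)
      have mg\<nu>: "g \<in> borel_measurable \<nu>" "T \<in> borel_measurable \<nu>"
        unfolding measurable_cong_sets[OF \<nu>(2) refl] by (fact mg T(2))+
      have 1: "\<bar>(\<integral>\<omega>. g (Y N \<omega>) \<partial>M) - (\<integral>\<omega>. T (Y N \<omega>) \<partial>M)\<bar>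
          \<le> e + (2 * B + e) * prob {\<omega>\<in>space M. \<exists>p\<in>D. \<bar>Y N \<omega> p\<bar> > R}"
        using D by (intro expectation_approx_off_event T(3) B(1) measurable_compose[OF mY] mg T(2) AE_I2)
          (auto intro!: less_imp_le[OF T(4)] Y_support less_imp_le[OF \<open>e > 0\<close>] sets.sets_Collect_finite_Ex
             borel_measurable_less simp: not_less)
      have "{x\<in>space \<nu>. \<exists>p\<in>D. \<bar>x p\<bar> > R} \<in> sets \<nu>"
        using D by (intro sets.sets_Collect_finite_Ex) measurable
      moreover have "AE x in \<nu>. x \<notin> {x\<in>space \<nu>. \<exists>p\<in>D. \<bar>x p\<bar> > R} \<longrightarrow> \<bar>g x - T x\<bar> \<le> e"
        using \<nu>(3) AE_space by eventually_elim (auto intro!: less_imp_le[OF T(4)] simp: not_less)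
      ultimately have 2: "\<bar>(\<integral>x. g x \<partial>\<nu>) - (\<integral>x. T x \<partial>\<nu>)\<bar>
          \<le> e + (2 * B + e) * N.prob {x\<in>space \<nu>. \<exists>p\<in>D. \<bar>x p\<bar> > R}"
        using \<open>e > 0\<close> by (intro N.expectation_approx_off_event T(3) B(1) mg\<nu>) auto
      have le: "e + (2 * B + e) * q \<le> e + (2 * B + 1) * e" if "q < e" "q \<ge> 0" for q
        using that e B by (intro add_left_mono mult_mono) auto
      have "\<bar>(\<integral>\<omega>. g (Y N \<omega>) \<partial>M) - (\<integral>x. g x \<partial>\<nu>)\<bar> < e + 2 * (e + (2 * B + 1) * e)"
        using order_trans[OF 1 le[OF elim(2)]] order_trans[OF 2 le[OF R2[OF R(3)]]] elim(1)
        by (auto simp: measure_nonneg abs_real_def split: if_splits)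
      also have "\<dots> = e * (4 * B + 5)" by (simp add: algebra_simps)
      finally show ?case using e by simp
    qed
  qed
qed

section \<open>Gaussian vectors\<close>

text \<open>Cholesky factorization by induction on the index set: splitting off one index leaves the
  Schur complement, which is again positive semidefinite. Singular matrices are covered, with zero
  pivots treated separately.\<close>

lemma gram_decomposition:
  fixes S :: "'i \<Rightarrow> 'i \<Rightarrow> real"
  assumes "finite I" and sym: "\<And>p q. S p q = S q p"
    and psd: "\<And>t. (\<Sum>p\<in>I. \<Sum>q\<in>I. t p * S p q * t q) \<ge> 0"
  shows "\<exists>L. \<forall>p\<in>I. \<forall>q\<in>I. S p q = (\<Sum>r\<in>I. L p r * L q r)"
  using assms
proof (induction I arbitrary: S rule: finite_induct)
  case (insert a I)
  note sym = insert.prems(1) and psd = insert.prems(2)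
  define F where "F = (\<lambda>t. \<Sum>p\<in>I. \<Sum>q\<in>I. t p * S p q * t q)"
  define b where "b = (\<lambda>t. \<Sum>q\<in>I. t q * S q a)"
  have form: "(\<Sum>p\<in>insert a I. \<Sum>q\<in>insert a I. (t(a := c)) p * S p q * (t(a := c)) q)
      = c\<^sup>2 * S a a + 2 * c * b t + F t" for t c
  proof -
    have ne: "p \<noteq> a" if "p \<in> I" for p using that insert.hyps by auto
    have 1: "(\<Sum>q\<in>I. c * S a q * (t(a := c)) q) = c * b t"
      unfolding b_def sum_distrib_left by (rule sum.cong) (auto simp: sym[of a] ne)
    have 2: "(\<Sum>p\<in>I. (t(a := c)) p * S p a * c) = c * b t"
      unfolding b_def sum_distrib_left by (rule sum.cong) (auto simp: ne)
    have 3: "(\<Sum>p\<in>I. \<Sum>q\<in>I. (t(a := c)) p * S p q * (t(a := c)) q) = F t"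
      unfolding F_def by (intro sum.cong) (auto simp: ne)
    have "(\<Sum>p\<in>insert a I. \<Sum>q\<in>insert a I. (t(a := c)) p * S p q * (t(a := c)) q)
      = c * S a a * c + (\<Sum>q\<in>I. c * S a q * (t(a := c)) q) + ((\<Sum>p\<in>I. (t(a := c)) p * S p a * c)
        + (\<Sum>p\<in>I. \<Sum>q\<in>I. (t(a := c)) p * S p q * (t(a := c)) q))"
      unfolding sum.insert[OF insert.hyps] sum.distrib fun_upd_same by (simp add: add.assoc)
    then show ?thesis unfolding 1 2 3 by (simp add: power2_eq_square)
  qed
  have nonneg: "c\<^sup>2 * S a a + 2 * c * b t + F t \<ge> 0" for c t
    using psd[of "t(a := c)"] unfolding form .
  have aa: "S a a \<ge> 0"
    using nonneg[of 1 "\<lambda>_. 0"] by (simp add: b_def F_def)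
  \<comment> \<open>With a zero pivot the form is affine in \<open>c\<close>. A nonzero slope
    \<open>2 * S q a\<close> would let it become negative; the value chosen for \<open>c\<close>
    below makes it equal to -1.\<close>
  have deg: "S q a = 0" if "S a a = 0" "q \<in> I" for q
  proof (rule ccontr)
    assume ne: "S q a \<noteq> 0"
    define t where "t = (\<lambda>r. if r = q then 1 else 0 :: real)"
    have "b t = S q a"
      using insert.hyps that by (simp add: b_def t_def if_distrib[of "\<lambda>u. u * _"] cong: if_cong)
    then show False
      using nonneg[of "- (F t + 1) / (2 * S q a)" t] ne that by (simp add: field_simps)
  qed
  \<comment> \<open>The Schur complement of the entry at \<open>a\<close>. For
    \<open>S a a = 0\<close> division by zero gives 0, so \<open>S'\<close> is then \<open>S\<close>
    itself.\<close>
  define S' where "S' = (\<lambda>p q. S p q - S p a * S q a / S a a)"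
  have "\<exists>L. \<forall>p\<in>I. \<forall>q\<in>I. S' p q = (\<Sum>r\<in>I. L p r * L q r)"
  proof (rule insert.IH)
    show "S' p q = S' q p" for p q by (simp add: S'_def sym[of p q] mult.commute)
    fix t
    have "(\<Sum>p\<in>I. \<Sum>q\<in>I. t p * S' p q * t q) = F t - (\<Sum>p\<in>I. \<Sum>q\<in>I. (t p * S p a) * (t q * S q a) / S a a)"
      unfolding F_def S'_def sum_subtractf[symmetric] by (intro sum.cong) (auto simp: algebra_simps)
    also have "\<dots> = F t - (b t)\<^sup>2 / S a a"
      by (simp add: b_def power2_eq_square sum_product sum_divide_distrib)
    also have "\<dots> \<ge> 0"
    proof (cases "S a a = 0")
      case True
      then show ?thesis using nonneg[of 0 t] by simp
    next
      case False
      \<comment> \<open>The form is evaluated at the minimizing coefficient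
        \<open>c = - b t / S a a\<close>, where it equals the Schur complement form.\<close>
      then show ?thesis
        using nonneg[of "- b t / S a a" t] by (simp add: field_simps power2_eq_square)
    qed
    finally show "(\<Sum>p\<in>I. \<Sum>q\<in>I. t p * S' p q * t q) \<ge> 0" .
  qed
  then obtain L' where L': "\<And>p q. p \<in> I \<Longrightarrow> q \<in> I \<Longrightarrow> S' p q = (\<Sum>r\<in>I. L' p r * L' q r)" by blast
  \<comment> \<open>The column of \<open>a\<close> contributes the rank one matrix removed in
    \<open>S'\<close>; elsewhere the row of \<open>a\<close> is zero. A zero pivot yields a zero
    column, which is correct by \<open>deg\<close>.\<close>
  define L where "L = (\<lambda>p r. if r = a then S p a / sqrt (S a a) else if p = a then 0 else L' p r)"
  have ne: "r \<noteq> a" if "r \<in> I" for r using that insert.hyps by auto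
  have eq: "(\<Sum>r\<in>insert a I. L p r * L q r) = S p a * S q a / S a a + (\<Sum>r\<in>I. L p r * L q r)" for p q
    using insert.hyps aa by (simp add: L_def)
  have II: "(\<Sum>r\<in>I. L p r * L q r) = (\<Sum>r\<in>I. L' p r * L' q r)" if "p \<in> I" "q \<in> I" for p q
    using that by (intro sum.cong) (auto simp: L_def ne)
  have aI: "(\<Sum>r\<in>I. L a r * L q r) = 0" "(\<Sum>r\<in>I. L q r * L a r) = 0" for q
    by (auto simp: L_def ne intro!: sum.neutral)
  show ?case
  proof (intro exI[of _ L] ballI)
    fix p q assume p: "p \<in> insert a I" and q: "q \<in> insert a I"
    have cancel: "S a a * S q a / S a a = S q a" if "q \<in> insert a I" for q
      using deg[of q] that by auto
    show "S p q = (\<Sum>r\<in>insert a I. L p r * L q r)"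
    proof (cases "p = a \<or> q = a")
      case True
      then show ?thesis
      proof
        assume "p = a"
        then show ?thesis
          unfolding eq using cancel[OF q] sym[of a q] by (simp only: aI)
      next
        assume "q = a"
        then show ?thesis
          unfolding eq using cancel[OF p] by (simp only: aI mult.commute[of "S p a"])
      qed
    next
      case False
      then show ?thesis
        unfolding eq using p q by (auto simp: II L'[symmetric] S'_def)
    qed
  qed
qed simp

text \<open>Countability of the index type makes the support condition a countable intersection.
  Measurability is what allows it to be carried over to an image measure.\<close>

lemma sets_borel_support:
  fixes I :: "'i::countable set"
  shows "{x \<in> space borel. \<forall>p. p \<notin> I \<longrightarrow> x p = (0::real)} \<in> sets borel"
proof -
  have "(\<lambda>x. x p) -` {0::real} \<inter> space borel \<in> sets borel" for p :: 'i
    by (intro measurable_sets[OF measurable_product_coordinates]) auto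
  then have "{x \<in> space borel. p \<notin> I \<longrightarrow> x p = (0::real)} \<in> sets borel" for p
    by (cases "p \<in> I") (auto simp: vimage_def Collect_conj_eq)
  then show ?thesis by (rule sets.sets_Collect_countable_All)
qed

text \<open>Independence means that the joint law is the product of the marginals; under a product
  measure the joint law of the coordinates is that measure itself.\<close>

lemma indep_vars_PiM_coordinates:
  assumes N: "\<And>i. prob_space (N i)" and sets: "\<And>i. sets (N i) = sets (B i)"
  shows "prob_space.indep_vars (PiM UNIV N) B (\<lambda>i x. x i) UNIV"
proof -
  interpret prob_space "PiM UNIV N" by (rule prob_space_PiM) (rule N)
  have m: "(\<lambda>x. x i) \<in> measurable (PiM UNIV N) (B i)" for i
    using measurable_component_singleton[of i UNIV N] unfolding measurable_cong_sets[OF refl sets[of i]] by simp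
  have eq: "distr (PiM UNIV N) (B i) (\<lambda>x. x i) = N i" for i
    using distr_PiM_component[of UNIV N i] N distr_cong[OF refl sets[of i] refl, of "PiM UNIV N" "\<lambda>x. x i"]
    by simp
  have "sets (PiM UNIV B) = sets (PiM UNIV N)"
    by (intro sets_PiM_cong) (auto simp: sets)
  then have "distr (PiM UNIV N) (PiM UNIV B) (\<lambda>x. \<lambda>i\<in>UNIV. x i) = PiM UNIV N"
    unfolding restrict_UNIV by (rule distr_id2)
  then show ?thesis
    using m by (subst indep_vars_iff_distr_eq_PiM') (auto simp: eq)
qed

lemma (in prob_space) integral_cis_sum_indep:
  assumes "indep_vars (\<lambda>_. borel) Z A"
  shows "(\<integral>\<omega>. cis (\<Sum>i\<in>A. Z i \<omega>) \<partial>M) = (\<Prod>i\<in>A. \<integral>\<omega>. cis (Z i \<omega>) \<partial>M)"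
proof -
  have m[measurable]: "random_variable borel (Z i)" if "i \<in> A" for i
    using assms that by (auto simp: indep_vars_def)
  have "(\<integral>\<omega>. cis (\<Sum>i\<in>A. Z i \<omega>) \<partial>M) = char (distr M borel (\<lambda>\<omega>. \<Sum>i\<in>A. Z i \<omega>)) 1"
    by (simp add: char_def integral_distr cis_conv_exp)
  also have "\<dots> = (\<Prod>i\<in>A. char (distr M borel (Z i)) 1)"
    by (rule char_distr_sum) fact
  also have "\<dots> = (\<Prod>i\<in>A. \<integral>\<omega>. cis (Z i \<omega>) \<partial>M)"
    by (intro prod.cong) (auto simp: char_def integral_distr cis_conv_exp)
  finally show ?thesis .
qed

text \<open>If S = L L^T and x is a vector of independent standard normals, then L x has the
  characteristic function exp(-|L^T t|^2 / 2), whose exponent is the quadratic form of S. No inverse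
  of S enters.\<close>

lemma centered_gaussian_exists:
  fixes S :: "'i::countable \<Rightarrow> 'i \<Rightarrow> real"
  assumes I: "finite I" and "\<And>p q. S p q = S q p"
    and "\<And>t. (\<Sum>p\<in>I. \<Sum>q\<in>I. t p * S p q * t q) \<ge> 0"
  obtains \<mu> where "centered_gaussian \<mu> I S"
proof -
  obtain L where L: "\<And>p q. p \<in> I \<Longrightarrow> q \<in> I \<Longrightarrow> S p q = (\<Sum>r\<in>I. L p r * L q r)"
    using gram_decomposition[OF assms] by blast
  define Q where "Q = PiM (UNIV :: 'i set) (\<lambda>_. std_normal_distribution)"
  have N: "prob_space std_normal_distribution"
    by (simp add: prob_space_normal_density)
  interpret Q: prob_space Q unfolding Q_def by (rule prob_space_PiM) (rule N)
  have ind: "Q.indep_vars (\<lambda>_. borel) (\<lambda>i x. x i) UNIV"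
    unfolding Q_def by (rule indep_vars_PiM_coordinates) (auto simp: N)
  have m[measurable]: "(\<lambda>x. x i) \<in> borel_measurable Q" for i
    using ind by (auto simp: Q.indep_vars_def)
  define T where "T = (\<lambda>x p. if p \<in> I then \<Sum>r\<in>I. L p r * x r else 0)"
  have T[measurable]: "T \<in> borel_measurable Q"
    by (rule measurable_coordinatewise_then_product) (auto simp: T_def)
  have coord: "distr Q borel (\<lambda>x. x r) = std_normal_distribution" for r
    using distr_PiM_component[of UNIV "\<lambda>_. std_normal_distribution" r] N
      distr_cong[of Q Q borel std_normal_distribution "\<lambda>x. x r" "\<lambda>x. x r"]
    unfolding Q_def by simp
  have normal: "(\<integral>x. cis (c * x r) \<partial>Q) = complex_of_real (exp (- c\<^sup>2 / 2))" for c r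
  proof -
    have "(\<integral>x. cis (c * x r) \<partial>Q) = char (distr Q borel (\<lambda>x. x r)) c"
      by (simp add: char_def integral_distr cis_conv_exp)
    then show ?thesis unfolding coord char_std_normal_distribution .
  qed
  have "centered_gaussian (distr Q borel T) I S"
    unfolding centered_gaussian_def
  proof (intro conjI allI)
    show "prob_space (distr Q borel T)" by (rule Q.prob_space_distr) simp
    show "AE x in distr Q borel T. \<forall>p. p \<notin> I \<longrightarrow> x p = 0"
    proof (subst AE_distr_iff)
      show "{x \<in> space borel. \<forall>p. p \<notin> I \<longrightarrow> x p = (0::real)} \<in> sets borel"
        by (rule sets_borel_support)
    next
      show "AE x in Q. \<forall>p. p \<notin> I \<longrightarrow> T x p = 0" by (simp add: T_def)
    qed simp
    fix t :: "'i \<Rightarrow> real"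
    \<comment> \<open>This is L^T t: pairing \<open>t\<close> with the image vector amounts to
      pairing \<open>c\<close> with the standard normals.\<close>
    define c where "c = (\<lambda>r. \<Sum>p\<in>I. t p * L p r)"
    have c: "(\<Sum>p\<in>I. t p * T x p) = (\<Sum>r\<in>I. c r * x r)" for x
      unfolding c_def T_def by (simp add: sum_distrib_left sum_distrib_right mult.assoc) (rule sum.swap)
    have c2: "(\<Sum>r\<in>I. (c r)\<^sup>2) = (\<Sum>p\<in>I. \<Sum>q\<in>I. t p * S p q * t q)"
    proof -
      have "(\<Sum>r\<in>I. (c r)\<^sup>2) = (\<Sum>r\<in>I. \<Sum>p\<in>I. \<Sum>q\<in>I. t p * L p r * (t q * L q r))"
        by (simp add: c_def power2_eq_square sum_product)
      also have "\<dots> = (\<Sum>p\<in>I. \<Sum>r\<in>I. \<Sum>q\<in>I. t p * L p r * (t q * L q r))"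
        by (rule sum.swap)
      also have "\<dots> = (\<Sum>p\<in>I. \<Sum>q\<in>I. \<Sum>r\<in>I. t p * L p r * (t q * L q r))"
        by (intro sum.cong refl sum.swap)
      also have "\<dots> = (\<Sum>p\<in>I. \<Sum>q\<in>I. t p * S p q * t q)"
        by (intro sum.cong refl) (simp add: L sum_distrib_left sum_distrib_right mult_ac)
      finally show ?thesis .
    qed
    have "(\<lambda>x. cis (\<Sum>p\<in>I. t p * x p)) \<in> borel_measurable borel"
      unfolding cis_conv_exp by measurable
    then have "(\<integral>x. cis (\<Sum>p\<in>I. t p * x p) \<partial>distr Q borel T) = (\<integral>x. cis (\<Sum>r\<in>I. c r * x r) \<partial>Q)"
      by (subst integral_distr) (auto simp: c)
    also have "\<dots> = (\<Prod>r\<in>I. \<integral>x. cis (c r * x r) \<partial>Q)"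
    proof (rule Q.integral_cis_sum_indep)
      show "Q.indep_vars (\<lambda>_. borel) (\<lambda>r x. c r * x r) I"
        by (rule Q.indep_vars_compose2[OF Q.indep_vars_subset[OF ind]]) auto
    qed
    also have "\<dots> = complex_of_real (exp (\<Sum>r\<in>I. - (c r)\<^sup>2 / 2))"
      by (simp add: normal exp_sum I)
    also have "(\<Sum>r\<in>I. - (c r)\<^sup>2 / 2) = - (\<Sum>p\<in>I. \<Sum>q\<in>I. t p * S p q * t q) / 2"
      by (simp add: c2[symmetric] sum_negf sum_divide_distrib)
    finally show "(\<integral>x. cis (\<Sum>p\<in>I. t p * x p) \<partial>distr Q borel T)
        = complex_of_real (exp (- (\<Sum>p\<in>I. \<Sum>q\<in>I. t p * S p q * t q) / 2))" .
  qed simp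
  then show ?thesis by (rule that)
qed

section \<open>A central limit theorem for K-dependent sequences\<close>

lemma norm_cis_diff_le: "cmod (cis a - cis b) \<le> \<bar>a - b\<bar>"
proof -
  have "cmod (cis a - cis b) = cmod (cis b * (cis (a - b) - 1))"
    by (simp add: algebra_simps cis_mult)
  also have "\<dots> = cmod (iexp (a - b) - (\<Sum>k \<le> 0. (\<i> * (a - b)) ^ k / fact k))"
    by (simp add: norm_mult cis_conv_exp)
  also have "\<dots> \<le> \<bar>a - b\<bar> ^ Suc 0 / fact (Suc 0)"
    by (rule iexp_approx1)
  finally show ?thesis by simp
qed

lemma (in prob_space) expectation_abs_le_sqrt:
  fixes Z :: "'a \<Rightarrow> real"
  assumes [measurable]: "random_variable borel Z" and Z: "integrable M (\<lambda>\<omega>. (Z \<omega>)\<^sup>2)"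
  shows "integrable M Z" "expectation (\<lambda>\<omega>. \<bar>Z \<omega>\<bar>) \<le> sqrt (expectation (\<lambda>\<omega>. (Z \<omega>)\<^sup>2))"
proof -
  show int: "integrable M Z" by (rule square_integrable_imp_integrable) fact+
  have "variance (\<lambda>\<omega>. \<bar>Z \<omega>\<bar>) \<ge> 0" by (rule variance_positive)
  also have "variance (\<lambda>\<omega>. \<bar>Z \<omega>\<bar>) = expectation (\<lambda>\<omega>. (Z \<omega>)\<^sup>2) - (expectation (\<lambda>\<omega>. \<bar>Z \<omega>\<bar>))\<^sup>2"
    using int Z by (subst variance_eq) auto
  finally show "expectation (\<lambda>\<omega>. \<bar>Z \<omega>\<bar>) \<le> sqrt (expectation (\<lambda>\<omega>. (Z \<omega>)\<^sup>2))"
    by (intro real_le_rsqrt) simp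
qed

text \<open>\<open>cis\<close> is 1-Lipschitz and the L1 norm is at most the L2 norm. A variance
  computation thus suffices to compare two characteristic functions.\<close>

lemma (in prob_space) norm_expectation_cis_diff_le:
  fixes Z W :: "'a \<Rightarrow> real"
  assumes [measurable]: "random_variable borel Z" "random_variable borel W"
    and int: "integrable M (\<lambda>\<omega>. (Z \<omega> - W \<omega>)\<^sup>2)"
  shows "cmod ((\<integral>\<omega>. cis (Z \<omega>) \<partial>M) - (\<integral>\<omega>. cis (W \<omega>) \<partial>M)) \<le> sqrt (expectation (\<lambda>\<omega>. (Z \<omega> - W \<omega>)\<^sup>2))"
proof -
  have i: "integrable M (\<lambda>\<omega>. cis (Z \<omega>))" "integrable M (\<lambda>\<omega>. cis (W \<omega>))"
    by (auto intro!: integrable_cis)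
  note e = expectation_abs_le_sqrt[OF _ int]
  have "cmod ((\<integral>\<omega>. cis (Z \<omega>) \<partial>M) - (\<integral>\<omega>. cis (W \<omega>) \<partial>M)) = cmod (\<integral>\<omega>. cis (Z \<omega>) - cis (W \<omega>) \<partial>M)"
    using i by simp
  also have "\<dots> \<le> (\<integral>\<omega>. cmod (cis (Z \<omega>) - cis (W \<omega>)) \<partial>M)"
    by (rule integral_norm_bound)
  also have "\<dots> \<le> (\<integral>\<omega>. \<bar>Z \<omega> - W \<omega>\<bar> \<partial>M)"
    using i e(1) by (intro integral_mono norm_cis_diff_le) auto
  also have "\<dots> \<le> sqrt (expectation (\<lambda>\<omega>. (Z \<omega> - W \<omega>)\<^sup>2))"
    by (rule e(2)) simp
  finally show ?thesis .
qed

text \<open>Pythagoras. Arbitrary weights are allowed because later error terms are differences of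
  two normalizations of the same sum.\<close>

lemma (in prob_space) expectation_orthogonal_sum_square:
  fixes \<xi> :: "nat \<Rightarrow> 'a \<Rightarrow> real"
  assumes "\<And>k l. integrable M (\<lambda>\<omega>. \<xi> k \<omega> * \<xi> l \<omega>)"
    and "\<And>k l. expectation (\<lambda>\<omega>. \<xi> k \<omega> * \<xi> l \<omega>) = (if k = l then v else 0)"
    and A: "finite A"
  shows "integrable M (\<lambda>\<omega>. (\<Sum>n\<in>A. c n * \<xi> n \<omega>)\<^sup>2)"
    "expectation (\<lambda>\<omega>. (\<Sum>n\<in>A. c n * \<xi> n \<omega>)\<^sup>2) = v * (\<Sum>n\<in>A. (c n)\<^sup>2)"
proof -
  have eq: "(\<Sum>n\<in>A. c n * \<xi> n \<omega>)\<^sup>2 = (\<Sum>k\<in>A. \<Sum>l\<in>A. c k * c l * (\<xi> k \<omega> * \<xi> l \<omega>))" for \<omega>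
    by (simp add: power2_eq_square sum_product mult_ac)
  show "integrable M (\<lambda>\<omega>. (\<Sum>n\<in>A. c n * \<xi> n \<omega>)\<^sup>2)"
    unfolding eq using assms by auto
  have "expectation (\<lambda>\<omega>. (\<Sum>n\<in>A. c n * \<xi> n \<omega>)\<^sup>2) = (\<Sum>k\<in>A. \<Sum>l\<in>A. c k * c l * (if k = l then v else 0))"
    unfolding eq using assms by (simp add: Bochner_Integration.integral_sum)
  also have "\<dots> = (\<Sum>k\<in>A. c k * c k * v)"
    using A by (intro sum.cong) (auto simp: if_distrib[of "\<lambda>u. _ * u"] cong: if_cong)
  finally show "expectation (\<lambda>\<omega>. (\<Sum>n\<in>A. c n * \<xi> n \<omega>)\<^sup>2) = v * (\<Sum>n\<in>A. (c n)\<^sup>2)"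
    by (simp add: sum_distrib_left power2_eq_square mult_ac)
qed

section \<open>Decomposition into blocks\<close>

lemma tendsto_div_ratio:
  assumes "L > 0"
  shows "(\<lambda>N. real (N div L) / real N) \<longlonglongrightarrow> 1 / real L"
proof (rule Lim_transform2)
  show "(\<lambda>_. 1 / real L) \<longlonglongrightarrow> 1 / real L" by simp
  show "(\<lambda>N. 1 / real L - real (N div L) / real N) \<longlonglongrightarrow> 0"
  proof (rule Lim_null_comparison[OF _ lim_1_over_n])
    show "\<forall>\<^sub>F N in sequentially. norm (1 / real L - real (N div L) / real N) \<le> 1 / real N"
      using eventually_gt_at_top[of 0]
    proof eventually_elim
      case (elim N)
      have "real N = real L * real (N div L) + real (N mod L)"
        by (metis div_mult_mod_eq mult.commute of_nat_add of_nat_mult)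
      then have "1 / real L - real (N div L) / real N = (real (N mod L) / real L) / real N"
        using assms elim by (simp add: field_simps)
      moreover have "real (N mod L) / real L / real N \<le> 1 / real N"
        using assms by (intro divide_right_mono) auto
      ultimately show ?case by simp
    qed
  qed
qed

text \<open>The block number of an index is its quotient by \<open>L\<close>, so the windows are
  disjoint, and functions of disjoint groups of independent variables are independent. In the
  application \<open>L\<close> covers a block together with its gap.\<close>

lemma (in prob_space) indep_vars_blocks:
  fixes X :: "nat \<Rightarrow> 'a \<Rightarrow> 'b"
  assumes X: "indep_vars (\<lambda>_. S) X UNIV" and H: "H \<in> borel_measurable (PiM {..<L} (\<lambda>_. S))"
  shows "indep_vars (\<lambda>_. borel) (\<lambda>b \<omega>. H (\<lambda>i\<in>{..<L}. X (b * L + i) \<omega>)) UNIV"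
proof -
  define J where "J = (\<lambda>b. {b * L..<b * L + L})"
  have "disjoint_family_on J UNIV"
  proof (unfold disjoint_family_on_def, intro ballI impI)
    fix b c :: nat assume "b \<noteq> c"
    have "n div L = b" if "n \<in> J b" for n b
      using that by (auto simp: J_def intro!: div_nat_eqI) (simp add: mult.commute)+
    then show "J b \<inter> J c = {}" using \<open>b \<noteq> c\<close> by blast
  qed
  then have "indep_vars (\<lambda>b. PiM (J b) (\<lambda>_. S)) (\<lambda>b \<omega>. restrict (\<lambda>i. X i \<omega>) (J b)) UNIV"
    by (intro indep_vars_restrict[OF X]) auto
  then have "indep_vars (\<lambda>_. borel) (\<lambda>b \<omega>. H (\<lambda>i\<in>{..<L}. restrict (\<lambda>i. X i \<omega>) (J b) (b * L + i))) UNIV"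
  proof (rule indep_vars_compose2[where Y="\<lambda>b z. H (\<lambda>i\<in>{..<L}. z (b * L + i))"])
    show "(\<lambda>z. H (\<lambda>i\<in>{..<L}. z (b * L + i))) \<in> borel_measurable (PiM (J b) (\<lambda>_. S))" for b
      by (rule measurable_compose[OF _ H], rule measurable_restrict,
          rule measurable_component_singleton) (auto simp: J_def)
  qed
  moreover have "(\<lambda>i\<in>{..<L}. restrict (\<lambda>i. X i \<omega>) (J b) (b * L + i)) = (\<lambda>i\<in>{..<L}. X (b * L + i) \<omega>)" for b \<omega>
    by (auto simp: J_def fun_eq_iff restrict_def)
  ultimately show ?thesis by simp
qed

lemma (in prob_space) indep_vars_reindex:
  assumes X: "indep_vars M' X I" and f: "inj_on f J" "f ` J \<subseteq> I"
  shows "indep_vars (\<lambda>j. M' (f j)) (\<lambda>j. X (f j)) J"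
proof -
  have "indep_vars (\<lambda>j. PiM {f j} M') (\<lambda>j \<omega>. restrict (\<lambda>n. X n \<omega>) {f j}) J"
    using f by (intro indep_vars_restrict[OF X]) (auto simp: disjoint_family_on_def inj_on_def)
  then have "indep_vars (\<lambda>j. M' (f j)) (\<lambda>j \<omega>. (restrict (\<lambda>n. X n \<omega>) {f j}) (f j)) J"
    by (rule indep_vars_compose2[where Y="\<lambda>j z. z (f j)"]) simp
  then show ?thesis by simp
qed

text \<open>The joint law of a window is a product of copies of \<mu> and so does not depend on the
  starting point \<open>a\<close>. This makes the block sums identically distributed.\<close>

lemma (in prob_space) distr_block:
  fixes X :: "nat \<Rightarrow> 'a \<Rightarrow> 'b"
  assumes X: "indep_vars (\<lambda>_. S) X UNIV" and id: "\<And>n. distr M S (X n) = \<mu>" and "L > 0"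
  shows "distr M (PiM {..<L} (\<lambda>_. S)) (\<lambda>\<omega>. \<lambda>i\<in>{..<L}. X (a + i) \<omega>) = PiM {..<L} (\<lambda>_. \<mu>)"
proof -
  have m: "X n \<in> measurable M S" for n using X by (auto simp: indep_vars_def)
  have "indep_vars (\<lambda>_. S) (\<lambda>i. X (a + i)) {..<L}"
    by (rule indep_vars_reindex[OF X]) auto
  then show ?thesis
    using m \<open>L > 0\<close> by (subst (asm) indep_vars_iff_distr_eq_PiM') (auto simp: id)
qed

text \<open>Since the terms are orthogonal, the distance between the full sum and the block sum is
  computed exactly and not merely estimated: its square is v (2 - 2 sqrt(q p / N)) for q blocks of
  length p. The proportion q p / N of retained terms tends to p / (p + K).\<close>

lemma (in prob_space) clt_m_dependent:
  fixes X :: "nat \<Rightarrow> 'a \<Rightarrow> 'b" and h :: "(nat \<Rightarrow> 'b) \<Rightarrow> real" and K :: nat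
  defines "\<xi> \<equiv> \<lambda>n \<omega>. h (\<lambda>i\<in>{..K}. X (n + i) \<omega>)"
  assumes X: "indep_vars (\<lambda>_. S) X UNIV" and id: "\<And>n. distr M S (X n) = \<mu>"
    and h: "h \<in> borel_measurable (PiM {..K} (\<lambda>_. S))"
    and int: "\<And>k l. integrable M (\<lambda>\<omega>. \<xi> k \<omega> * \<xi> l \<omega>)"
    and mean: "\<And>k. expectation (\<xi> k) = 0"
    and cov: "\<And>k l. expectation (\<lambda>\<omega>. \<xi> k \<omega> * \<xi> l \<omega>) = (if k = l then v else 0)"
  shows "(\<lambda>N. \<integral>\<omega>. cis ((\<Sum>n<N. \<xi> n \<omega>) / sqrt (real N)) \<partial>M) \<longlonglongrightarrow> complex_of_real (exp (- v / 2))"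
proof -
  have m: "X n \<in> measurable M S" for n using X by (auto simp: indep_vars_def)
  have m\<xi>[measurable]: "random_variable borel (\<xi> n)" for n
    unfolding \<xi>_def by (rule measurable_compose[OF _ h], rule measurable_restrict, rule m)
  note ort = expectation_orthogonal_sum_square[OF int cov]
  have "v \<ge> 0"
  proof -
    have "0 \<le> expectation (\<lambda>\<omega>. \<xi> 0 \<omega> * \<xi> 0 \<omega>)" by (rule Bochner_Integration.integral_nonneg) simp
    then show ?thesis by (simp add: cov)
  qed
  \<comment> \<open>Each term reads K + 1 consecutive variables, so a block of p terms reads p + K
    of them, exactly the distance between the starts of consecutive blocks.\<close>
  define Bl where "Bl = (\<lambda>p b \<omega>. \<Sum>l<p. \<xi> (b * (p + K) + l) \<omega>)"
  have mBl[measurable]: "random_variable borel (Bl p b)" for p b unfolding Bl_def by measurable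
  have block_clt: "(\<lambda>q. \<integral>\<omega>. cis ((\<Sum>b<q. Bl p b \<omega>) / sqrt (real (q * p))) \<partial>M) \<longlonglongrightarrow> complex_of_real (exp (- v / 2))"
    if "p > 0" "v > 0" for p
  proof -
    define L where "L = p + K"
    define H where "H = (\<lambda>y. \<Sum>l<p. h (\<lambda>i\<in>{..K}. y (l + i)))"
    have H: "H \<in> borel_measurable (PiM {..<L} (\<lambda>_. S))"
      unfolding H_def
      by (intro borel_measurable_sum measurable_compose[OF _ h] measurable_restrict measurable_component_singleton)
        (auto simp: L_def)
    have Bl: "Bl p b \<omega> = H (\<lambda>i\<in>{..<L}. X (b * L + i) \<omega>)" for b \<omega>
    proof -
      have "(\<lambda>i\<in>{..K}. (\<lambda>i\<in>{..<L}. X (b * L + i) \<omega>) (l + i)) = (\<lambda>i\<in>{..K}. X (b * L + l + i) \<omega>)" if "l < p" for l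
        using that by (auto simp: fun_eq_iff restrict_def L_def add.assoc)
      then show ?thesis by (simp add: Bl_def H_def \<xi>_def L_def)
    qed
    have indep: "indep_vars (\<lambda>_. borel) (Bl p) UNIV"
      unfolding Bl[abs_def] by (rule indep_vars_blocks[OF X H])
    have ident: "distr M borel (Bl p b) = distr (PiM {..<L} (\<lambda>_. \<mu>)) borel H" for b
    proof -
      have "distr M borel (Bl p b) = distr (distr M (PiM {..<L} (\<lambda>_. S)) (\<lambda>\<omega>. \<lambda>i\<in>{..<L}. X (b * L + i) \<omega>)) borel H"
        using H by (subst distr_distr) (auto simp: Bl[abs_def] comp_def intro!: measurable_restrict m)
      also have "\<dots> = distr (PiM {..<L} (\<lambda>_. \<mu>)) borel H"
        using \<open>p > 0\<close> by (subst distr_block[OF X id]) (auto simp: L_def)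
      finally show ?thesis .
    qed
    have Bl_sum: "Bl p b \<omega> = (\<Sum>n\<in>(\<lambda>l. b * L + l) ` {..<p}. 1 * \<xi> n \<omega>)" for b \<omega>
      by (subst sum.reindex) (auto simp: Bl_def L_def inj_on_def)
    have Bl_sq: "integrable M (\<lambda>\<omega>. (Bl p b \<omega>)\<^sup>2)" for b
      unfolding Bl_sum by (rule ort(1)) simp
    have Bl_var: "expectation (\<lambda>\<omega>. (Bl p b \<omega>)\<^sup>2) = (sqrt (p * v))\<^sup>2" for b
    proof -
      have "expectation (\<lambda>\<omega>. (Bl p b \<omega>)\<^sup>2) = v * (\<Sum>n\<in>(\<lambda>l. b * L + l) ` {..<p}. 1\<^sup>2)"
        unfolding Bl_sum by (rule ort(2)) simp
      also have "\<dots> = p * v" by (simp add: card_image)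
      also have "\<dots> = (sqrt (p * v))\<^sup>2"
        using that by (intro real_sqrt_pow2[symmetric] mult_nonneg_nonneg) auto
      finally show ?thesis .
    qed
    have \<xi>_int: "integrable M (\<xi> n)" for n
      using int[of n n] by (subst (asm) power2_eq_square[symmetric]) (rule square_integrable_imp_integrable, auto)
    have Bl_mean: "expectation (Bl p b) = 0" for b
      unfolding Bl_def using \<xi>_int by (simp add: mean)
    have "weak_conv_m (\<lambda>q. distr M borel (\<lambda>\<omega>. (\<Sum>b<q. Bl p b \<omega>) / sqrt (q * (sqrt (p * v))\<^sup>2))) std_normal_distribution"
    proof (rule central_limit_theorem_zero_mean[OF indep Bl_mean _ Bl_sq _ ident])
      show "sqrt (p * v) > 0" using that by simp
      show "variance (Bl p n) = (sqrt (p * v))\<^sup>2" for n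
        using Bl_var[of n] by (simp add: Bl_mean)
    qed
    \<comment> \<open>Evaluation at \<open>sqrt v\<close> cancels the factor \<open>sqrt v\<close>
      in the normalization of the classical theorem and leaves division by
      \<open>sqrt (q * p)\<close>.\<close>
    then have "(\<lambda>q. char (distr M borel (\<lambda>\<omega>. (\<Sum>b<q. Bl p b \<omega>) / sqrt (q * (sqrt (p * v))\<^sup>2))) (sqrt v))
        \<longlonglongrightarrow> char std_normal_distribution (sqrt v)"
      by (rule levy_continuity1[rotated 2])
        (auto intro!: real_distribution_distr real_dist_normal_dist)
    also have "char std_normal_distribution (sqrt v) = complex_of_real (exp (- v / 2))"
      using that by (simp add: char_std_normal_distribution)
    also have "(\<lambda>q. char (distr M borel (\<lambda>\<omega>. (\<Sum>b<q. Bl p b \<omega>) / sqrt (q * (sqrt (p * v))\<^sup>2))) (sqrt v))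
       = (\<lambda>q. \<integral>\<omega>. cis ((\<Sum>b<q. Bl p b \<omega>) / sqrt (real (q * p))) \<partial>M)"
      using that by (auto simp: fun_eq_iff char_def integral_distr cis_conv_exp real_sqrt_mult)
    finally show ?thesis .
  qed
  have compare: "cmod ((\<integral>\<omega>. cis ((\<Sum>n<N. \<xi> n \<omega>) / sqrt (real N)) \<partial>M)
      - (\<integral>\<omega>. cis ((\<Sum>b<N div (p + K). Bl p b \<omega>) / sqrt (real (N div (p + K) * p))) \<partial>M))
      \<le> sqrt (v * (2 - 2 * sqrt (real (N div (p + K)) / real N * real p)))"
    if "p > 0" "N \<ge> p + K" for p N
  proof -
    define L where "L = p + K"
    define q where "q = N div L"
    define A where "A = (\<lambda>(b, l). b * L + l) ` ({..<q} \<times> {..<p})"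
    have "L > 0" "N > 0" "q > 0" using that by (auto simp: L_def q_def div_greater_zero_iff)
    have inj: "inj_on (\<lambda>(b, l). b * L + l) ({..<q} \<times> {..<p})"
    proof (rule inj_onI, clarsimp)
      fix b l b' l' assume *: "b * L + l = b' * L + l'" "l < p" "l' < p"
      have "l < L" "l' < L" using * by (auto simp: L_def)
      then have "(b * L + l) div L = b" "(b' * L + l') div L = b'"
        using \<open>L > 0\<close> by simp_all
      then have "b = b'" using *(1) by simp
      then show "b = b' \<and> l = l'" using *(1) by simp
    qed
    have card: "card A = q * p"
      unfolding A_def using inj by (simp add: card_image)
    have sub: "A \<subseteq> {..<N}"
    proof (clarsimp simp: A_def)
      fix b l assume "b < q" "l < p"
      then have "b * L + l < (b + 1) * L" by (simp add: L_def)
      also have "\<dots> \<le> q * L" using \<open>b < q\<close> by (intro mult_right_mono) auto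
      also have "\<dots> \<le> N" by (simp add: q_def)
      finally show "b * L + l < N" .
    qed
    have sumA: "(\<Sum>b<q. Bl p b \<omega>) = (\<Sum>n\<in>A. \<xi> n \<omega>)" for \<omega>
      unfolding A_def by (subst sum.reindex[OF inj]) (simp add: Bl_def sum.cartesian_product L_def split_def)
    \<comment> \<open>The weight of \<xi> n in the difference: gap terms keep 1 / sqrt N, block
      terms the difference of the two normalizations. Both normalized sums have squared weights
      adding up to 1, whence the two in the result.\<close>
    define c where "c = (\<lambda>n. 1 / sqrt N - (if n \<in> A then 1 / sqrt (q * p) else 0))"
    have diff: "(\<Sum>n<N. \<xi> n \<omega>) / sqrt N - (\<Sum>b<q. Bl p b \<omega>) / sqrt (q * p) = (\<Sum>n<N. c n * \<xi> n \<omega>)" for \<omega>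
    proof -
      have "(\<Sum>n\<in>A. \<xi> n \<omega>) = (\<Sum>n<N. if n \<in> A then \<xi> n \<omega> else 0)"
        using sub by (subst sum.inter_restrict[symmetric]) (auto simp: Int_absorb1)
      then show ?thesis
        unfolding sumA c_def
        by (simp add: sum_divide_distrib sum_subtractf[symmetric]) (intro sum.cong refl, simp add: left_diff_distrib)
    qed
    have qp: "real q * real p > 0" using \<open>q > 0\<close> \<open>p > 0\<close> by simp
    have "(\<Sum>n<N. (c n)\<^sup>2) = (\<Sum>n<N. 1 / real N + (if n \<in> A then 1 / (q * p) - 2 / (sqrt N * sqrt (q * p)) else 0))"
      using qp \<open>N > 0\<close> by (intro sum.cong) (auto simp: c_def power2_diff power_divide)
    also have "\<dots> = 1 + (q * p) * (1 / (q * p) - 2 / (sqrt N * sqrt (q * p)))"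
    proof -
      have "(\<Sum>n<N. if n \<in> A then u else 0) = real (q * p) * u" for u :: real
        using sub by (subst sum.inter_restrict[symmetric]) (auto simp: Int_absorb1 card)
      then show ?thesis using \<open>N > 0\<close> by (simp add: sum.distrib)
    qed
    also have "\<dots> = 2 - 2 * sqrt (real q / real N * real p)"
    proof -
      have "real q * real p * (2 / (sqrt N * sqrt (q * p))) = 2 * ((real q * real p) / sqrt (real q * real p) / sqrt N)"
        by (simp add: mult_ac)
      also have "(real q * real p) / sqrt (real q * real p) = sqrt (q * p)"
        using qp by (subst real_div_sqrt) auto
      finally have "real q * real p * (2 / (sqrt N * sqrt (q * p))) = 2 * (sqrt (q * p) / sqrt N)" .
      then show ?thesis
        using \<open>q > 0\<close> \<open>p > 0\<close> by (simp add: right_diff_distrib real_sqrt_divide real_sqrt_mult)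
    qed
    finally have c2: "(\<Sum>n<N. (c n)\<^sup>2) = 2 - 2 * sqrt (real q / real N * real p)" .
    have "cmod ((\<integral>\<omega>. cis ((\<Sum>n<N. \<xi> n \<omega>) / sqrt (real N)) \<partial>M)
        - (\<integral>\<omega>. cis ((\<Sum>b<q. Bl p b \<omega>) / sqrt (real (q * p))) \<partial>M))
       \<le> sqrt (expectation (\<lambda>\<omega>. ((\<Sum>n<N. \<xi> n \<omega>) / sqrt (real N) - (\<Sum>b<q. Bl p b \<omega>) / sqrt (real (q * p)))\<^sup>2))"
    proof (rule norm_expectation_cis_diff_le)
      show "integrable M (\<lambda>\<omega>. ((\<Sum>n<N. \<xi> n \<omega>) / sqrt (real N) - (\<Sum>b<q. Bl p b \<omega>) / sqrt (real (q * p)))\<^sup>2)"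
        unfolding diff by (rule ort(1)) simp
    qed measurable
    also have "\<dots> = sqrt (v * (2 - 2 * sqrt (real q / real N * real p)))"
      unfolding diff by (simp add: ort(2) c2)
    finally show ?thesis by (simp add: q_def L_def)
  qed
  show ?thesis
  proof (cases "v = 0")
    \<comment> \<open>The sums vanish in L2 and the limit is 1. The classical theorem, which divides
      by the standard deviation, cannot be applied here.\<close>
    case True
    have "cmod ((\<integral>\<omega>. cis ((\<Sum>n<N. \<xi> n \<omega>) / sqrt (real N)) \<partial>M) - (\<integral>\<omega>. cis 0 \<partial>M)) \<le> 0" for N
    proof -
      have eq: "(\<Sum>n<N. \<xi> n \<omega>) / sqrt (real N) - 0 = (\<Sum>n<N. (1 / sqrt (real N)) * \<xi> n \<omega>)" for \<omega>
        by (simp add: sum_divide_distrib)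
      have "cmod ((\<integral>\<omega>. cis ((\<Sum>n<N. \<xi> n \<omega>) / sqrt (real N)) \<partial>M) - (\<integral>\<omega>. cis 0 \<partial>M))
          \<le> sqrt (expectation (\<lambda>\<omega>. ((\<Sum>n<N. \<xi> n \<omega>) / sqrt (real N) - 0)\<^sup>2))"
      proof (rule norm_expectation_cis_diff_le)
        show "integrable M (\<lambda>\<omega>. ((\<Sum>n<N. \<xi> n \<omega>) / sqrt (real N) - 0)\<^sup>2)"
          unfolding eq by (rule ort(1)) simp
      qed measurable
      also have "\<dots> = 0" unfolding eq by (simp only: ort(2) finite_lessThan True) simp
      finally show ?thesis .
    qed
    then show ?thesis using True by (simp add: prob_space)
  next
    case False
    then have "v > 0" using \<open>v \<ge> 0\<close> by simp
    have "(\<lambda>p. sqrt (v * (2 - 2 * sqrt (real p / real (p + K))))) \<longlonglongrightarrow> sqrt (v * (2 - 2 * sqrt 1))"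
    proof (intro tendsto_intros)
      show "(\<lambda>p. real p / real (p + K)) \<longlonglongrightarrow> 1"
        by real_asymp
    qed
    then have lim_p: "(\<lambda>p. sqrt (v * (2 - 2 * sqrt (real p / real (p + K))))) \<longlonglongrightarrow> 0" by simp
    show ?thesis
      unfolding tendsto_iff
    proof (intro allI impI)
      fix e :: real assume "e > 0"
      have "\<forall>\<^sub>F p in sequentially. sqrt (v * (2 - 2 * sqrt (real p / real (p + K)))) < e / 2 \<and> p > 0"
        using \<open>e > 0\<close> by (intro eventually_conj order_tendstoD(2)[OF lim_p] eventually_gt_at_top) auto
      \<comment> \<open>The block length is fixed before N: it makes the limit in N of the
        comparison error small, and only then does the number of blocks grow.\<close>
      then obtain p where p: "sqrt (v * (2 - 2 * sqrt (real p / real (p + K)))) < e / 2" "p > 0"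
        by (auto simp: eventually_sequentially)
      have "(\<lambda>N. sqrt (v * (2 - 2 * sqrt (real (N div (p + K)) / real N * real p))))
          \<longlonglongrightarrow> sqrt (v * (2 - 2 * sqrt (1 / real (p + K) * real p)))"
        using p by (intro tendsto_intros tendsto_div_ratio) auto
      then have 1: "\<forall>\<^sub>F N in sequentially. sqrt (v * (2 - 2 * sqrt (real (N div (p + K)) / real N * real p))) < e / 2"
        using p by (intro order_tendstoD(2)) auto
      have "filterlim (\<lambda>N. N div (p + K)) at_top sequentially"
        unfolding filterlim_at_top
      proof
        fix Z show "\<forall>\<^sub>F N in sequentially. Z \<le> N div (p + K)"
          using eventually_ge_at_top[of "Z * (p + K)"]
          by eventually_elim (use \<open>p > 0\<close> in \<open>simp add: less_eq_div_iff_mult_less_eq\<close>)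
      qed
      from filterlim_compose[OF block_clt[OF \<open>p > 0\<close> \<open>v > 0\<close>] this]
      have 2: "\<forall>\<^sub>F N in sequentially.
          dist (\<integral>\<omega>. cis ((\<Sum>b<N div (p + K). Bl p b \<omega>) / sqrt (real (N div (p + K) * p))) \<partial>M)
            (complex_of_real (exp (- v / 2))) < e / 2"
        using \<open>e > 0\<close> unfolding tendsto_iff by (meson half_gt_zero)
      show "\<forall>\<^sub>F N in sequentially. dist (\<integral>\<omega>. cis ((\<Sum>n<N. \<xi> n \<omega>) / sqrt (real N)) \<partial>M)
            (complex_of_real (exp (- v / 2))) < e"
        using 1 2 eventually_ge_at_top[of "p + K"]
      proof eventually_elim
        case (elim N)
        have "dist (\<integral>\<omega>. cis ((\<Sum>n<N. \<xi> n \<omega>) / sqrt (real N)) \<partial>M)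
            (\<integral>\<omega>. cis ((\<Sum>b<N div (p + K). Bl p b \<omega>) / sqrt (real (N div (p + K) * p))) \<partial>M) < e / 2"
          using compare[OF \<open>p > 0\<close> elim(3)] elim(1) by (simp add: dist_norm)
        with elim(2) show ?case by (metis dist_triangle_half_r dist_commute)
      qed
    qed
  qed
qed

section \<open>Convergence in probability\<close>

text \<open>Convergence to 0 in probability, o_P(1). Measurability is included so that the tail sets
  are events.\<close>

definition (in prob_space) vanishes_in_prob :: "(nat \<Rightarrow> 'a \<Rightarrow> real) \<Rightarrow> bool" where
  "vanishes_in_prob Y \<longleftrightarrow> (\<forall>N. random_variable borel (Y N)) \<and>
     (\<forall>r>0. \<forall>e>0. \<forall>\<^sub>F N in sequentially. prob {\<omega>\<in>space M. \<bar>Y N \<omega>\<bar> > r} < e)"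

context prob_space
begin

lemma prob_le_add:
  assumes "A \<subseteq> B \<union> C" "B \<in> events" "C \<in> events"
  shows "prob A \<le> prob B + prob C"
proof -
  have "prob A \<le> prob (B \<union> C)" using assms by (intro finite_measure_mono) auto
  also have "\<dots> \<le> prob B + prob C" using assms by (intro measure_Un_le)
  finally show ?thesis .
qed

lemma abs_tail_event: "random_variable borel (Y :: 'a \<Rightarrow> real) \<Longrightarrow> {\<omega>\<in>space M. \<bar>Y \<omega>\<bar> > r} \<in> events"
  by measurable

lemma vanishes_in_prob_measurable: "vanishes_in_prob Y \<Longrightarrow> random_variable borel (Y N)"
  by (simp add: vanishes_in_prob_def)

lemma vanishes_in_probD:
  "vanishes_in_prob Y \<Longrightarrow> r > 0 \<Longrightarrow> e > 0 \<Longrightarrow>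
    \<forall>\<^sub>F N in sequentially. prob {\<omega>\<in>space M. \<bar>Y N \<omega>\<bar> > r} < e"
  by (simp add: vanishes_in_prob_def)

lemma bounded_in_prob_measurable: "bounded_in_prob Y \<Longrightarrow> random_variable borel (Y N)"
  by (simp add: bounded_in_prob_def)

lemma chebyshev_second_moment:
  fixes Y :: "'a \<Rightarrow> real"
  assumes [measurable]: "random_variable borel Y" and int: "integrable M (\<lambda>\<omega>. (Y \<omega>)\<^sup>2)" and "r > 0"
  shows "prob {\<omega>\<in>space M. \<bar>Y \<omega>\<bar> > r} \<le> expectation (\<lambda>\<omega>. (Y \<omega>)\<^sup>2) / r\<^sup>2"
proof -
  have "prob {\<omega>\<in>space M. \<bar>Y \<omega>\<bar> > r} \<le> prob {\<omega>\<in>space M. (Y \<omega>)\<^sup>2 \<ge> r\<^sup>2}"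
    using \<open>r > 0\<close> by (intro finite_measure_mono) (auto simp: abs_le_square_iff[symmetric])
  also have "\<dots> \<le> expectation (\<lambda>\<omega>. (Y \<omega>)\<^sup>2) / r\<^sup>2"
    using \<open>r > 0\<close> by (intro integral_Markov_inequality_measure[OF int, of "{}"]) auto
  finally show ?thesis .
qed

lemma vanishes_in_probI_L2:
  assumes m: "\<And>N. random_variable borel (Y N)" and int: "\<And>N. integrable M (\<lambda>\<omega>. (Y N \<omega>)\<^sup>2)"
    and lim: "(\<lambda>N. expectation (\<lambda>\<omega>. (Y N \<omega>)\<^sup>2)) \<longlonglongrightarrow> 0"
  shows "vanishes_in_prob Y"
  unfolding vanishes_in_prob_def
proof (intro conjI allI impI m)
  fix r e :: real assume "r > 0" "e > 0"
  have "\<forall>\<^sub>F N in sequentially. expectation (\<lambda>\<omega>. (Y N \<omega>)\<^sup>2) < e * r\<^sup>2"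
    using \<open>r > 0\<close> \<open>e > 0\<close> by (intro order_tendstoD(2)[OF lim]) simp
  then show "\<forall>\<^sub>F N in sequentially. prob {\<omega>\<in>space M. \<bar>Y N \<omega>\<bar> > r} < e"
  proof eventually_elim
    case (elim N)
    have "expectation (\<lambda>\<omega>. (Y N \<omega>)\<^sup>2) / r\<^sup>2 < e"
      using elim \<open>r > 0\<close> by (simp add: pos_divide_less_eq)
    with chebyshev_second_moment[OF m int \<open>r > 0\<close>, of N] show ?case by simp
  qed
qed

lemma bounded_in_probI_L2:
  assumes m: "\<And>N. random_variable borel (Y N)" and int: "\<And>N. integrable M (\<lambda>\<omega>. (Y N \<omega>)\<^sup>2)"
    and bound: "\<And>N. expectation (\<lambda>\<omega>. (Y N \<omega>)\<^sup>2) \<le> B"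
  shows "bounded_in_prob Y"
  unfolding bounded_in_prob_def
proof (intro conjI allI impI m)
  fix e :: real assume "e > 0"
  have "B \<ge> 0"
    by (rule order_trans[OF _ bound[of 0]]) simp
  \<comment> \<open>Then \<open>B / R\<^sup>2 = e * (B / (B + 1)) < e\<close>. Using
    \<open>B + 1\<close> in place of \<open>B\<close> keeps \<open>R\<close> positive and the
    inequality strict also for \<open>B = 0\<close>.\<close>
  define R where "R = sqrt ((B + 1) / e)"
  have "R > 0" using \<open>e > 0\<close> \<open>B \<ge> 0\<close> by (simp add: R_def)
  have "prob {\<omega>\<in>space M. \<bar>Y N \<omega>\<bar> > R} < e" for N
  proof -
    have "prob {\<omega>\<in>space M. \<bar>Y N \<omega>\<bar> > R} \<le> expectation (\<lambda>\<omega>. (Y N \<omega>)\<^sup>2) / R\<^sup>2"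
      by (rule chebyshev_second_moment[OF m int \<open>R > 0\<close>])
    also have "\<dots> \<le> B / R\<^sup>2" by (intro divide_right_mono bound) simp
    also have "\<dots> = e * (B / (B + 1))" using \<open>e > 0\<close> \<open>B \<ge> 0\<close> by (simp add: R_def)
    also have "\<dots> < e" using \<open>e > 0\<close> \<open>B \<ge> 0\<close> by (simp add: field_simps)
    finally show ?thesis .
  qed
  then show "\<exists>R. \<forall>\<^sub>F N in sequentially. prob {\<omega>\<in>space M. \<bar>Y N \<omega>\<bar> > R} < e"
    by (intro exI[of _ R] always_eventually allI)
qed

lemma vanishes_in_prob_bounded: "vanishes_in_prob Y \<Longrightarrow> bounded_in_prob Y"
  unfolding vanishes_in_prob_def bounded_in_prob_def by (meson zero_less_one)

text \<open>Domination is asked for large N only: the identities between sample quantities fail or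
  degenerate while N does not exceed the lag.\<close>

lemma vanishes_in_prob_cong:
  assumes Y: "vanishes_in_prob Y" and m: "\<And>N. random_variable borel (Z N)"
    and eq: "\<forall>\<^sub>F N in sequentially. \<forall>\<omega>\<in>space M. \<bar>Z N \<omega>\<bar> \<le> \<bar>Y N \<omega>\<bar>"
  shows "vanishes_in_prob Z"
  unfolding vanishes_in_prob_def
proof (intro conjI allI impI m)
  fix r e :: real assume "r > 0" "e > 0"
  then have "\<forall>\<^sub>F N in sequentially. prob {\<omega>\<in>space M. \<bar>Y N \<omega>\<bar> > r} < e"
    using Y by (auto simp: vanishes_in_prob_def)
  with eq show "\<forall>\<^sub>F N in sequentially. prob {\<omega>\<in>space M. \<bar>Z N \<omega>\<bar> > r} < e"
  proof eventually_elim
    case (elim N)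
    have "prob {\<omega>\<in>space M. \<bar>Z N \<omega>\<bar> > r} \<le> prob {\<omega>\<in>space M. \<bar>Y N \<omega>\<bar> > r}"
      using elim by (intro finite_measure_mono abs_tail_event vanishes_in_prob_measurable[OF Y]) force
    then show ?case using elim by simp
  qed
qed

section \<open>Slutsky calculus\<close>

lemma vanishes_in_prob_add:
  assumes Y: "vanishes_in_prob Y" and Z: "vanishes_in_prob Z"
  shows "vanishes_in_prob (\<lambda>N \<omega>. Y N \<omega> + Z N \<omega>)"
  unfolding vanishes_in_prob_def
proof (intro conjI allI impI)
  note m = vanishes_in_prob_measurable[OF Y] vanishes_in_prob_measurable[OF Z]
  show "random_variable borel (\<lambda>\<omega>. Y N \<omega> + Z N \<omega>)" for N
    by (intro borel_measurable_add m)
  fix r e :: real assume "r > 0" "e > 0"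
  then have "\<forall>\<^sub>F N in sequentially. prob {\<omega>\<in>space M. \<bar>Y N \<omega>\<bar> > r / 2} < e / 2"
    "\<forall>\<^sub>F N in sequentially. prob {\<omega>\<in>space M. \<bar>Z N \<omega>\<bar> > r / 2} < e / 2"
    by - (intro vanishes_in_probD Y Z half_gt_zero; assumption)+
  then show "\<forall>\<^sub>F N in sequentially. prob {\<omega>\<in>space M. \<bar>Y N \<omega> + Z N \<omega>\<bar> > r} < e"
  proof eventually_elim
    case (elim N)
    have "prob {\<omega>\<in>space M. \<bar>Y N \<omega> + Z N \<omega>\<bar> > r}
        \<le> prob {\<omega>\<in>space M. \<bar>Y N \<omega>\<bar> > r / 2} + prob {\<omega>\<in>space M. \<bar>Z N \<omega>\<bar> > r / 2}"
      by (intro prob_le_add abs_tail_event m) auto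
    then show ?case using elim by simp
  qed
qed

lemma bounded_in_prob_add:
  assumes Y: "bounded_in_prob Y" and Z: "bounded_in_prob Z"
  shows "bounded_in_prob (\<lambda>N \<omega>. Y N \<omega> + Z N \<omega>)"
  unfolding bounded_in_prob_def
proof (intro conjI allI impI)
  note m = bounded_in_prob_measurable[OF Y] bounded_in_prob_measurable[OF Z]
  show "random_variable borel (\<lambda>\<omega>. Y N \<omega> + Z N \<omega>)" for N
    by (intro borel_measurable_add m)
  fix e :: real assume "e > 0"
  then have "e / 2 > 0" by simp
  with Y Z obtain R1 R2 where
    "\<forall>\<^sub>F N in sequentially. prob {\<omega>\<in>space M. \<bar>Y N \<omega>\<bar> > R1} < e / 2"
    "\<forall>\<^sub>F N in sequentially. prob {\<omega>\<in>space M. \<bar>Z N \<omega>\<bar> > R2} < e / 2"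
    unfolding bounded_in_prob_def by meson
  then have "\<forall>\<^sub>F N in sequentially. prob {\<omega>\<in>space M. \<bar>Y N \<omega> + Z N \<omega>\<bar> > R1 + R2} < e"
  proof eventually_elim
    case (elim N)
    have "prob {\<omega>\<in>space M. \<bar>Y N \<omega> + Z N \<omega>\<bar> > R1 + R2}
        \<le> prob {\<omega>\<in>space M. \<bar>Y N \<omega>\<bar> > R1} + prob {\<omega>\<in>space M. \<bar>Z N \<omega>\<bar> > R2}"
      by (intro prob_le_add abs_tail_event m) auto
    then show ?case using elim by simp
  qed
  then show "\<exists>R. \<forall>\<^sub>F N in sequentially. prob {\<omega>\<in>space M. \<bar>Y N \<omega> + Z N \<omega>\<bar> > R} < e" by blast
qed

text \<open>With high probability the bounded factor is below a constant \<open>R\<close>, and then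
  \<open>Y\<close> only has to fall below \<open>r / R\<close>. The maximum with 1 keeps
  \<open>R\<close> positive.\<close>

lemma vanishes_in_prob_mult:
  assumes Y: "vanishes_in_prob Y" and Z: "bounded_in_prob Z"
  shows "vanishes_in_prob (\<lambda>N \<omega>. Y N \<omega> * Z N \<omega>)"
  unfolding vanishes_in_prob_def
proof (intro conjI allI impI)
  note m = vanishes_in_prob_measurable[OF Y] bounded_in_prob_measurable[OF Z]
  show "random_variable borel (\<lambda>\<omega>. Y N \<omega> * Z N \<omega>)" for N
    by (intro borel_measurable_times m)
  fix r e :: real assume "r > 0" "e > 0"
  then have "e / 2 > 0" by simp
  with Z obtain R0 where R0: "\<forall>\<^sub>F N in sequentially. prob {\<omega>\<in>space M. \<bar>Z N \<omega>\<bar> > R0} < e / 2"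
    unfolding bounded_in_prob_def by meson
  define R where "R = max R0 1"
  have "R \<ge> R0" "R > 0" by (auto simp: R_def)
  have "\<forall>\<^sub>F N in sequentially. prob {\<omega>\<in>space M. \<bar>Y N \<omega>\<bar> > r / R} < e / 2"
    using \<open>r > 0\<close> \<open>R > 0\<close> \<open>e > 0\<close> by (intro vanishes_in_probD[OF Y]) auto
  with R0 show "\<forall>\<^sub>F N in sequentially. prob {\<omega>\<in>space M. \<bar>Y N \<omega> * Z N \<omega>\<bar> > r} < e"
  proof eventually_elim
    case (elim N)
    have "\<bar>Y N \<omega> * Z N \<omega>\<bar> \<le> r" if "\<bar>Y N \<omega>\<bar> \<le> r / R" "\<bar>Z N \<omega>\<bar> \<le> R0" for \<omega>
    proof -
      have "\<bar>Y N \<omega>\<bar> * \<bar>Z N \<omega>\<bar> \<le> (r / R) * R"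
        using that \<open>R \<ge> R0\<close> \<open>r > 0\<close> \<open>R > 0\<close> by (intro mult_mono) auto
      then show ?thesis using \<open>R > 0\<close> by (simp add: abs_mult)
    qed
    then have "prob {\<omega>\<in>space M. \<bar>Y N \<omega> * Z N \<omega>\<bar> > r}
        \<le> prob {\<omega>\<in>space M. \<bar>Y N \<omega>\<bar> > r / R} + prob {\<omega>\<in>space M. \<bar>Z N \<omega>\<bar> > R0}"
      by (intro prob_le_add abs_tail_event m) (force simp: not_less)
    then show ?case using elim by simp
  qed
qed

lemma bounded_in_prob_const_real: "bounded_in_prob (\<lambda>_ _. c)"
  by (rule bounded_in_prob_const) simp

lemma vanishes_in_prob_cmult: "vanishes_in_prob Y \<Longrightarrow> vanishes_in_prob (\<lambda>N \<omega>. c * Y N \<omega>)"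
  using vanishes_in_prob_mult[OF _ bounded_in_prob_const_real, of Y c] by (simp add: mult.commute)

lemma vanishes_in_prob_diff:
  assumes "vanishes_in_prob Y" "vanishes_in_prob Z"
  shows "vanishes_in_prob (\<lambda>N \<omega>. Y N \<omega> - Z N \<omega>)"
  using vanishes_in_prob_add[OF assms(1) vanishes_in_prob_cmult[OF assms(2), of "-1"]] by simp

lemma vanishes_in_prob_zero: "vanishes_in_prob (\<lambda>_ _. 0)"
  by (auto simp: vanishes_in_prob_def)

lemma vanishes_in_prob_sum:
  assumes "\<And>p. p \<in> D \<Longrightarrow> vanishes_in_prob (Y p)"
  shows "vanishes_in_prob (\<lambda>N \<omega>. \<Sum>p\<in>D. Y p N \<omega>)"
  using assms
proof (induction D rule: infinite_finite_induct)
  case (insert p D)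
  then have "vanishes_in_prob (\<lambda>N \<omega>. Y p N \<omega> + (\<Sum>p\<in>D. Y p N \<omega>))"
    by (intro vanishes_in_prob_add) auto
  then show ?case using insert.hyps by simp
qed (simp_all add: vanishes_in_prob_zero)

text \<open>Continuous mapping at a constant limit. Continuity is local at \<open>c\<close>, since
  the application is to u \<mapsto> 1 / sqrt u at 1, which blows up near 0.\<close>

lemma vanishes_in_prob_isCont:
  fixes \<phi> :: "real \<Rightarrow> real"
  assumes Y: "vanishes_in_prob (\<lambda>N \<omega>. Y N \<omega> - c)" and m: "\<And>N. random_variable borel (Y N)"
    and \<phi>: "\<phi> \<in> borel_measurable borel" and cont: "isCont \<phi> c"
  shows "vanishes_in_prob (\<lambda>N \<omega>. \<phi> (Y N \<omega>) - \<phi> c)"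
  unfolding vanishes_in_prob_def
proof (intro conjI allI impI)
  show m': "random_variable borel (\<lambda>\<omega>. \<phi> (Y N \<omega>) - \<phi> c)" for N
    using measurable_compose[OF m \<phi>] by (intro borel_measurable_diff) auto
  fix r e :: real assume "r > 0" "e > 0"
  with cont obtain d where d: "d > 0" "\<And>x. \<bar>x - c\<bar> < d \<Longrightarrow> \<bar>\<phi> x - \<phi> c\<bar> < r"
    unfolding continuous_at_eps_delta dist_real_def by meson
  have "\<forall>\<^sub>F N in sequentially. prob {\<omega>\<in>space M. \<bar>Y N \<omega> - c\<bar> > d / 2} < e"
    using d(1) \<open>e > 0\<close> by (intro vanishes_in_probD[OF Y]) auto
  then show "\<forall>\<^sub>F N in sequentially. prob {\<omega>\<in>space M. \<bar>\<phi> (Y N \<omega>) - \<phi> c\<bar> > r} < e"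
  proof eventually_elim
    case (elim N)
    have "\<bar>Y N \<omega> - c\<bar> > d / 2" if "\<bar>\<phi> (Y N \<omega>) - \<phi> c\<bar> > r" for \<omega>
      using d(2)[of "Y N \<omega>"] d(1) that by (cases "\<bar>Y N \<omega> - c\<bar> < d") auto
    then have "prob {\<omega>\<in>space M. \<bar>\<phi> (Y N \<omega>) - \<phi> c\<bar> > r} \<le> prob {\<omega>\<in>space M. \<bar>Y N \<omega> - c\<bar> > d / 2}"
      by (intro finite_measure_mono abs_tail_event vanishes_in_prob_measurable[OF Y]) auto
    then show ?case using elim by simp
  qed
qed

text \<open>Slutsky for characteristic functions: off the event that the variables differ by more
  than \<open>e / 4\<close> the Lipschitz bound applies, on it the trivial bound 2.\<close>

lemma cis_expectation_diff_tendsto_0: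
  assumes Y: "\<And>N. random_variable borel (Y N)" and Z: "\<And>N. random_variable borel (Z N)"
    and van: "vanishes_in_prob (\<lambda>N \<omega>. Y N \<omega> - Z N \<omega>)"
  shows "(\<lambda>N. (\<integral>\<omega>. cis (Y N \<omega>) \<partial>M) - (\<integral>\<omega>. cis (Z N \<omega>) \<partial>M)) \<longlonglongrightarrow> 0"
  unfolding tendsto_iff dist_0_norm dist_commute[of _ 0]
proof (intro allI impI)
  fix e :: real assume "e > 0"
  then have "\<forall>\<^sub>F N in sequentially. prob {\<omega>\<in>space M. \<bar>Y N \<omega> - Z N \<omega>\<bar> > e / 4} < e / 4"
    by (intro vanishes_in_probD[OF van]) auto
  then show "\<forall>\<^sub>F N in sequentially. cmod ((\<integral>\<omega>. cis (Y N \<omega>) \<partial>M) - (\<integral>\<omega>. cis (Z N \<omega>) \<partial>M)) < e"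
  proof eventually_elim
    case (elim N)
    define A where "A = {\<omega>\<in>space M. \<bar>Y N \<omega> - Z N \<omega>\<bar> > e / 4}"
    have A: "A \<in> events" unfolding A_def by (rule abs_tail_event vanishes_in_prob_measurable[OF van])+
    have intA: "integrable M (indicator A :: 'a \<Rightarrow> real)"
      using A by (intro integrable_const_bound[of _ 1]) (auto simp: indicator_def)
    have i: "integrable M (\<lambda>\<omega>. cis (Y N \<omega>))" "integrable M (\<lambda>\<omega>. cis (Z N \<omega>))"
      by (intro integrable_cis Y Z)+
    have "cmod ((\<integral>\<omega>. cis (Y N \<omega>) \<partial>M) - (\<integral>\<omega>. cis (Z N \<omega>) \<partial>M)) = cmod (\<integral>\<omega>. cis (Y N \<omega>) - cis (Z N \<omega>) \<partial>M)"
      using i by simp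
    also have "\<dots> \<le> (\<integral>\<omega>. cmod (cis (Y N \<omega>) - cis (Z N \<omega>)) \<partial>M)"
      by (rule integral_norm_bound)
    also have "\<dots> \<le> (\<integral>\<omega>. e / 4 + 2 * indicator A \<omega> \<partial>M)"
    proof (rule integral_mono)
      fix \<omega> assume "\<omega> \<in> space M"
      show "cmod (cis (Y N \<omega>) - cis (Z N \<omega>)) \<le> e / 4 + 2 * indicator A \<omega>"
      proof (cases "\<omega> \<in> A")
        case True
        then show ?thesis
          using norm_triangle_ineq4[of "cis (Y N \<omega>)" "cis (Z N \<omega>)"] \<open>e > 0\<close> by simp
      next
        case False
        then show ?thesis
          using norm_cis_diff_le[of "Y N \<omega>" "Z N \<omega>"] \<open>\<omega> \<in> space M\<close> by (simp add: A_def)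
      qed
    qed (use i intA in auto)
    also have "\<dots> = e / 4 + 2 * prob A" using intA A by (simp add: prob_space)
    also have "\<dots> < e" using elim \<open>e > 0\<close> by (simp add: A_def)
    finally show ?case .
  qed
qed

end

section \<open>Moments of lagged products\<close>

locale iid_sequence = prob_space M for M :: "'a measure" +
  fixes X :: "nat \<Rightarrow> 'a \<Rightarrow> real"
  assumes indep: "indep_vars (\<lambda>_. borel) X {1..}"
    and ident: "i \<ge> 1 \<Longrightarrow> distr M borel (X i) = distr M borel (X 1)"
begin

text \<open>Counting from 0 fits the sums over \<open>{..<N}\<close> and the windows of the central
  limit theorem, whereas the sample is numbered from 1.\<close>

abbreviation Z :: "nat \<Rightarrow> 'a \<Rightarrow> real" where "Z n \<equiv> X (Suc n)"

definition fourth_moment :: "(real \<Rightarrow> real) \<Rightarrow> bool" where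
  "fourth_moment a \<longleftrightarrow> a \<in> borel_measurable borel \<and> integrable M (\<lambda>\<omega>. (a (Z 0 \<omega>)) ^ 4)"

definition standardized :: "(real \<Rightarrow> real) \<Rightarrow> bool" where
  "standardized a \<longleftrightarrow> fourth_moment a \<and> expectation (\<lambda>\<omega>. a (Z 0 \<omega>)) = 0
     \<and> expectation (\<lambda>\<omega>. (a (Z 0 \<omega>))\<^sup>2) = 1"

lemma indep_Z: "indep_vars (\<lambda>_. borel) Z UNIV"
  using indep_vars_reindex[OF indep, of Suc UNIV] by auto

lemma measurable_Z[measurable]: "random_variable borel (Z n)"
  using indep_Z by (auto simp: indep_vars_def)

lemma distr_Z: "distr M borel (Z n) = distr M borel (Z 0)"
  using ident[of "Suc n"] by simp

lemma shift_Z: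
  fixes a :: "real \<Rightarrow> real"
  assumes [measurable]: "a \<in> borel_measurable borel"
  shows integrable_Z: "integrable M (\<lambda>\<omega>. a (Z n \<omega>)) \<longleftrightarrow> integrable M (\<lambda>\<omega>. a (Z 0 \<omega>))"
    and expectation_Z: "expectation (\<lambda>\<omega>. a (Z n \<omega>)) = expectation (\<lambda>\<omega>. a (Z 0 \<omega>))"
proof -
  have "integrable M (\<lambda>\<omega>. a (Z n \<omega>)) \<longleftrightarrow> integrable (distr M borel (Z n)) a" for n
    by (subst integrable_distr_eq) auto
  from this[of n] this[of 0]
  show "integrable M (\<lambda>\<omega>. a (Z n \<omega>)) \<longleftrightarrow> integrable M (\<lambda>\<omega>. a (Z 0 \<omega>))"
    by (simp only: distr_Z[of n])
  have "expectation (\<lambda>\<omega>. a (Z n \<omega>)) = integral\<^sup>L (distr M borel (Z n)) a" for n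
    by (subst integral_distr) auto
  from this[of n] this[of 0]
  show "expectation (\<lambda>\<omega>. a (Z n \<omega>)) = expectation (\<lambda>\<omega>. a (Z 0 \<omega>))"
    by (simp only: distr_Z[of n])
qed

lemma fourth_moment_measurable: "fourth_moment a \<Longrightarrow> a \<in> borel_measurable borel"
  by (simp add: fourth_moment_def)

lemma fourth_moment_const: "fourth_moment (\<lambda>_. c)"
  by (simp add: fourth_moment_def)

lemma integrable_fourth_moment: "fourth_moment a \<Longrightarrow> integrable M (\<lambda>\<omega>. (a (Z n \<omega>)) ^ 4)"
  by (subst integrable_Z) (auto simp: fourth_moment_def)

text \<open>The inequality between arithmetic and geometric mean, applied twice, dominates the
  product by the sum of fourth powers. The bound is pointwise, so the four indices may coincide in
  any pattern.\<close>

lemma integrable_mult4: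
  assumes a: "fourth_moment a" "fourth_moment b" "fourth_moment c" "fourth_moment d"
  shows "integrable M (\<lambda>\<omega>. a (Z p \<omega>) * b (Z q \<omega>) * c (Z r \<omega>) * d (Z s \<omega>))"
proof (rule Bochner_Integration.integrable_bound)
  note a[THEN fourth_moment_measurable, measurable]
  show "integrable M (\<lambda>\<omega>. (a (Z p \<omega>)) ^ 4 + (b (Z q \<omega>)) ^ 4 + (c (Z r \<omega>)) ^ 4 + (d (Z s \<omega>)) ^ 4)"
    by (intro Bochner_Integration.integrable_add integrable_fourth_moment a)
  show "(\<lambda>\<omega>. a (Z p \<omega>) * b (Z q \<omega>) * c (Z r \<omega>) * d (Z s \<omega>)) \<in> borel_measurable M"
    by measurable
  have "\<bar>u * v * w * x\<bar> \<le> u ^ 4 + v ^ 4 + w ^ 4 + x ^ 4" for u v w x :: real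
  proof -
    have two: "2 * \<bar>y * z\<bar> \<le> y\<^sup>2 + z\<^sup>2" for y z :: real
      using sum_squares_bound[of "\<bar>y\<bar>" "\<bar>z\<bar>"] by (simp add: abs_mult)
    have "2 * \<bar>u * v * w * x\<bar> \<le> (u * v)\<^sup>2 + (w * x)\<^sup>2"
      using two[of "u * v" "w * x"] by (simp add: mult.assoc)
    moreover have "2 * (u * v)\<^sup>2 \<le> u ^ 4 + v ^ 4" "2 * (w * x)\<^sup>2 \<le> w ^ 4 + x ^ 4"
      using two[of "u\<^sup>2" "v\<^sup>2"] two[of "w\<^sup>2" "x\<^sup>2"] by (auto simp: power_mult_distrib)
    moreover have "0 \<le> u ^ 4" "0 \<le> v ^ 4" "0 \<le> w ^ 4" "0 \<le> x ^ 4" by auto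
    ultimately show ?thesis by linarith
  qed
  then show "AE \<omega> in M. norm (a (Z p \<omega>) * b (Z q \<omega>) * c (Z r \<omega>) * d (Z s \<omega>))
      \<le> norm ((a (Z p \<omega>)) ^ 4 + (b (Z q \<omega>)) ^ 4 + (c (Z r \<omega>)) ^ 4 + (d (Z s \<omega>)) ^ 4)"
    unfolding real_norm_def by (intro AE_I2 order_trans[OF _ abs_ge_self])
qed

lemma integrable_mult2:
  "fourth_moment a \<Longrightarrow> fourth_moment b \<Longrightarrow> integrable M (\<lambda>\<omega>. a (Z p \<omega>) * b (Z q \<omega>))"
  using integrable_mult4[OF _ _ fourth_moment_const[of 1] fourth_moment_const[of 1], of a b p q] by simp

lemma integrable_mult1: "fourth_moment a \<Longrightarrow> integrable M (\<lambda>\<omega>. a (Z p \<omega>))"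
  using integrable_mult2[OF _ fourth_moment_const[of 1], of a p] by simp

text \<open>\<open>Z l\<close> is independent of the whole family over \<open>J\<close> jointly, not
  just of each member, so the second factor may involve several variables.\<close>

lemma expectation_mult_indep:
  fixes \<phi> :: "real \<Rightarrow> real" and g :: "(nat \<Rightarrow> real) \<Rightarrow> real"
  assumes \<phi>: "\<phi> \<in> borel_measurable borel" and g: "g \<in> borel_measurable (PiM J (\<lambda>_. borel))" and "l \<notin> J"
    and int: "integrable M (\<lambda>\<omega>. \<phi> (Z l \<omega>))" "integrable M (\<lambda>\<omega>. g (\<lambda>n\<in>J. Z n \<omega>))"
  shows "expectation (\<lambda>\<omega>. \<phi> (Z l \<omega>) * g (\<lambda>n\<in>J. Z n \<omega>))
      = expectation (\<lambda>\<omega>. \<phi> (Z l \<omega>)) * expectation (\<lambda>\<omega>. g (\<lambda>n\<in>J. Z n \<omega>))"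
    and "integrable M (\<lambda>\<omega>. \<phi> (Z l \<omega>) * g (\<lambda>n\<in>J. Z n \<omega>))"
proof -
  have "indep_var borel ((\<lambda>z. \<phi> (z l)) \<circ> (\<lambda>\<omega>. \<lambda>n\<in>{l}. Z n \<omega>)) borel (g \<circ> (\<lambda>\<omega>. \<lambda>n\<in>J. Z n \<omega>))"
  proof (rule indep_var_compose[OF indep_var_restrict[OF indep_Z]])
    show "(\<lambda>z. \<phi> (z l)) \<in> borel_measurable (PiM {l} (\<lambda>_. borel))"
      by (rule measurable_compose[OF _ \<phi>]) simp
  qed (use \<open>l \<notin> J\<close> g in auto)
  then have ind: "indep_var borel (\<lambda>\<omega>. \<phi> (Z l \<omega>)) borel (\<lambda>\<omega>. g (\<lambda>n\<in>J. Z n \<omega>))"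
    by (simp add: comp_def)
  from indep_var_lebesgue_integral[OF ind int] indep_var_integrable[OF ind int]
  show "expectation (\<lambda>\<omega>. \<phi> (Z l \<omega>) * g (\<lambda>n\<in>J. Z n \<omega>))
      = expectation (\<lambda>\<omega>. \<phi> (Z l \<omega>)) * expectation (\<lambda>\<omega>. g (\<lambda>n\<in>J. Z n \<omega>))"
    "integrable M (\<lambda>\<omega>. \<phi> (Z l \<omega>) * g (\<lambda>n\<in>J. Z n \<omega>))" .
qed

lemma expectation_mult_distinct:
  fixes \<phi> \<psi> :: "real \<Rightarrow> real"
  assumes [measurable]: "\<phi> \<in> borel_measurable borel" "\<psi> \<in> borel_measurable borel" and "l \<noteq> r"
    and int: "integrable M (\<lambda>\<omega>. \<phi> (Z 0 \<omega>))" "integrable M (\<lambda>\<omega>. \<psi> (Z 0 \<omega>))"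
  shows "expectation (\<lambda>\<omega>. \<phi> (Z l \<omega>) * \<psi> (Z r \<omega>)) = expectation (\<lambda>\<omega>. \<phi> (Z 0 \<omega>)) * expectation (\<lambda>\<omega>. \<psi> (Z 0 \<omega>))"
    and "integrable M (\<lambda>\<omega>. \<phi> (Z l \<omega>) * \<psi> (Z r \<omega>))"
proof -
  have g: "(\<lambda>z. \<psi> (z r)) \<in> borel_measurable (PiM {r} (\<lambda>_. borel))" by measurable
  have i: "integrable M (\<lambda>\<omega>. \<phi> (Z l \<omega>))" "integrable M (\<lambda>\<omega>. (\<lambda>z. \<psi> (z r)) (\<lambda>n\<in>{r}. Z n \<omega>))"
    using int by (simp_all add: integrable_Z[of \<phi> l] integrable_Z[of \<psi> r])
  note * = expectation_mult_indep[OF assms(1) g _ i]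
  show "expectation (\<lambda>\<omega>. \<phi> (Z l \<omega>) * \<psi> (Z r \<omega>)) = expectation (\<lambda>\<omega>. \<phi> (Z 0 \<omega>)) * expectation (\<lambda>\<omega>. \<psi> (Z 0 \<omega>))"
    using *(1) \<open>l \<noteq> r\<close> unfolding expectation_Z[OF assms(1), of l, symmetric] expectation_Z[OF assms(2), of r, symmetric]
    by simp
  show "integrable M (\<lambda>\<omega>. \<phi> (Z l \<omega>) * \<psi> (Z r \<omega>))"
    using *(2) \<open>l \<noteq> r\<close> by simp
qed

text \<open>A centered factor whose index occurs nowhere else splits off with expectation 0,
  whatever coincidences there are among the other three indices.\<close>

lemma expectation_mult4_isolated:
  assumes "fourth_moment a" "fourth_moment b" "fourth_moment c" "fourth_moment d"
    and "expectation (\<lambda>\<omega>. a (Z 0 \<omega>)) = 0" and l: "l \<notin> {p, q, r}"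
  shows "expectation (\<lambda>\<omega>. a (Z l \<omega>) * b (Z p \<omega>) * c (Z q \<omega>) * d (Z r \<omega>)) = 0"
proof -
  note assms(1-4)[THEN fourth_moment_measurable, measurable]
  have i: "integrable M (\<lambda>\<omega>. (\<lambda>z. b (z p) * c (z q) * d (z r)) (\<lambda>n\<in>{p, q, r}. Z n \<omega>))"
    using integrable_mult4[OF fourth_moment_const[of 1] assms(2-4), of p q r] by simp
  have g: "(\<lambda>z. b (z p) * c (z q) * d (z r)) \<in> borel_measurable (PiM {p, q, r} (\<lambda>_. borel))"
    by measurable
  have "expectation (\<lambda>\<omega>. a (Z l \<omega>)) = 0"
    using expectation_Z[of a l] assms by simp
  then show ?thesis
    using expectation_mult_indep(1)[OF _ g l integrable_mult1[OF assms(1)] i] by (simp add: mult.assoc)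
qed

lemma lag_product_mean:
  assumes a: "standardized a" and b: "standardized b" and "k \<ge> 1"
  shows "expectation (\<lambda>\<omega>. a (Z n \<omega>) * b (Z (n + k) \<omega>)) = 0"
proof -
  have "expectation (\<lambda>\<omega>. a (Z n \<omega>) * b (Z (n + k) \<omega>) * 1 * 1) = 0"
    using a b \<open>k \<ge> 1\<close>
    by (intro expectation_mult4_isolated[of a b "\<lambda>_. 1" "\<lambda>_. 1" n "n + k" "n + k" "n + k"])
      (auto simp: standardized_def fourth_moment_const)
  then show ?thesis by simp
qed

text \<open>For different n and n' the smaller one is an index that occurs only once; for n = n'
  with different lags the index n + k occurs only once. In the remaining case the four factors form
  two pairs, at n and at n + k, which are independent.\<close>

lemma lag_product_covariance:
  assumes st: "standardized a" "standardized b" "standardized c" "standardized d" and k: "k \<ge> 1" "l \<ge> 1"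
  shows "expectation (\<lambda>\<omega>. (a (Z n \<omega>) * b (Z (n + k) \<omega>)) * (c (Z n' \<omega>) * d (Z (n' + l) \<omega>)))
    = (if n = n' \<and> k = l then expectation (\<lambda>\<omega>. a (Z 0 \<omega>) * c (Z 0 \<omega>)) * expectation (\<lambda>\<omega>. b (Z 0 \<omega>) * d (Z 0 \<omega>)) else 0)"
proof -
  have m: "fourth_moment e" "expectation (\<lambda>\<omega>. e (Z 0 \<omega>)) = 0" if "standardized e" for e
    using that by (simp_all only: standardized_def)
  consider "n < n'" | "n' < n" | "n = n'" "k \<noteq> l" | "n = n'" "k = l"
    using linorder_less_linear[of n n'] by blast
  then show ?thesis
  proof cases
    case 1
    then have "expectation (\<lambda>\<omega>. a (Z n \<omega>) * b (Z (n + k) \<omega>) * c (Z n' \<omega>) * d (Z (n' + l) \<omega>)) = 0"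
      using k by (intro expectation_mult4_isolated m st) auto
    then show ?thesis using 1 by (simp add: mult.assoc)
  next
    case 2
    then have "expectation (\<lambda>\<omega>. c (Z n' \<omega>) * d (Z (n' + l) \<omega>) * a (Z n \<omega>) * b (Z (n + k) \<omega>)) = 0"
      using k by (intro expectation_mult4_isolated m st) auto
    then show ?thesis using 2 by (simp add: mult_ac)
  next
    case 3
    then have "expectation (\<lambda>\<omega>. b (Z (n + k) \<omega>) * a (Z n \<omega>) * c (Z n \<omega>) * d (Z (n + l) \<omega>)) = 0"
      using k by (intro expectation_mult4_isolated m st) auto
    then show ?thesis using 3 by (simp add: mult_ac)
  next
    case 4
    note st[THEN m(1), THEN fourth_moment_measurable, measurable]
    have "expectation (\<lambda>\<omega>. (\<lambda>x. a x * c x) (Z n \<omega>) * (\<lambda>x. b x * d x) (Z (n + k) \<omega>))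
        = expectation (\<lambda>\<omega>. a (Z 0 \<omega>) * c (Z 0 \<omega>)) * expectation (\<lambda>\<omega>. b (Z 0 \<omega>) * d (Z 0 \<omega>))"
      using k by (intro expectation_mult_distinct(1) integrable_mult2 m st) auto
    then show ?thesis using 4 by (simp add: mult_ac)
  qed
qed

lemma lag_product_integrable:
  assumes "standardized a" "standardized b" "standardized c" "standardized d"
  shows "integrable M (\<lambda>\<omega>. (a (Z n \<omega>) * b (Z (n + k) \<omega>)) * (c (Z n' \<omega>) * d (Z (n' + l) \<omega>)))"
  using integrable_mult4[of a b c d n "n + k" n' "n' + l"] assms by (simp add: standardized_def mult.assoc)

end

section \<open>Sample autocovariances and autocorrelations\<close>

lemma hat_m_eq: "hat_m N f x = (\<Sum>n<N. f (x (Suc n))) / real N"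
  by (simp add: hat_m_def sum.atLeast1_atMost_eq)

lemma hat_s2_eq:
  assumes "N > 0"
  shows "hat_s2 N f x = (\<Sum>n<N. (f (x (Suc n)))\<^sup>2) / real N - (hat_m N f x)\<^sup>2"
proof -
  define m where "m = hat_m N f x"
  have s: "(\<Sum>n<N. f (x (Suc n))) = real N * m"
    using assms by (simp add: m_def hat_m_eq)
  have "(\<Sum>n<N. (f (x (Suc n)) - m)\<^sup>2) = (\<Sum>n<N. (f (x (Suc n)))\<^sup>2 - 2 * m * f (x (Suc n)) + m\<^sup>2)"
    by (intro sum.cong) (auto simp: power2_diff)
  also have "\<dots> = (\<Sum>n<N. (f (x (Suc n)))\<^sup>2) - 2 * m * (real N * m) + real N * m\<^sup>2"
    by (simp add: sum.distrib sum_subtractf sum_distrib_left[symmetric] s)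
  also have "\<dots> = (\<Sum>n<N. (f (x (Suc n)))\<^sup>2) - real N * m\<^sup>2"
    by (simp add: power2_eq_square)
  finally show ?thesis
    using assms by (simp add: hat_s2_def sum.atLeast1_atMost_eq m_def[symmetric] diff_divide_distrib)
qed

text \<open>The partial means run over the first and over the last N - k observations. Neither
  equals the full sample mean, so the cross terms do not merge as they do for the variance.\<close>

lemma hat_gamma_eq:
  assumes "k < N"
  shows "hat_gamma N k f g x = (\<Sum>n<N-k. f (x (Suc n)) * g (x (Suc (n + k)))) / real (N - k)
     - hat_m N g x * ((\<Sum>n<N-k. f (x (Suc n))) / real (N - k))
     - hat_m N f x * ((\<Sum>n<N-k. g (x (Suc (n + k)))) / real (N - k))
     + hat_m N f x * hat_m N g x"
proof -
  define a b where "a = hat_m N f x" and "b = hat_m N g x"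
  have "(\<Sum>n<N-k. (f (x (Suc n)) - a) * (g (x (Suc (n + k))) - b))
     = (\<Sum>n<N-k. f (x (Suc n)) * g (x (Suc (n + k))) - b * f (x (Suc n)) - a * g (x (Suc (n + k))) + a * b)"
    by (intro sum.cong) (auto simp: algebra_simps)
  also have "\<dots> = (\<Sum>n<N-k. f (x (Suc n)) * g (x (Suc (n + k)))) - b * (\<Sum>n<N-k. f (x (Suc n)))
     - a * (\<Sum>n<N-k. g (x (Suc (n + k)))) + real (N - k) * (a * b)"
    by (simp add: sum.distrib sum_subtractf sum_distrib_left)
  finally have "(\<Sum>n<N-k. (f (x (Suc n)) - a) * (g (x (Suc (n + k))) - b)) = \<dots>" .
  moreover have "hat_gamma N k f g x = (\<Sum>n<N-k. (f (x (Suc n)) - a) * (g (x (Suc (n + k))) - b)) / real (N - k)"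
    using assms by (simp add: hat_gamma_def sum.atLeast1_atMost_eq a_def b_def of_nat_diff)
  ultimately show ?thesis
    using assms by (simp add: a_def[symmetric] b_def[symmetric] add_divide_distrib diff_divide_distrib)
qed

text \<open>The second moment is v times the sum of squared weights, so questions of convergence and
  tightness turn into questions about deterministic sums. Index sets and weights may vary with
  N.\<close>

lemma (in prob_space) orthogonal_weighted_sums:
  fixes \<xi> :: "nat \<Rightarrow> 'a \<Rightarrow> real"
  assumes int: "\<And>k l. integrable M (\<lambda>\<omega>. \<xi> k \<omega> * \<xi> l \<omega>)"
    and cov: "\<And>k l. expectation (\<lambda>\<omega>. \<xi> k \<omega> * \<xi> l \<omega>) = (if k = l then v else 0)"
    and m: "\<And>n. random_variable borel (\<xi> n)" and A: "\<And>N. finite (A N)"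
  shows orthogonal_sum_vanishes: "(\<lambda>N. \<Sum>n\<in>A N. (c N n)\<^sup>2) \<longlonglongrightarrow> 0 \<Longrightarrow>
      vanishes_in_prob (\<lambda>N \<omega>. \<Sum>n\<in>A N. c N n * \<xi> n \<omega>)"
    and orthogonal_sum_bounded: "(\<And>N. (\<Sum>n\<in>A N. (c N n)\<^sup>2) \<le> 1) \<Longrightarrow>
      bounded_in_prob (\<lambda>N \<omega>. \<Sum>n\<in>A N. c N n * \<xi> n \<omega>)"
proof -
  note ort = expectation_orthogonal_sum_square[OF int cov A]
  have mm: "random_variable borel (\<lambda>\<omega>. \<Sum>n\<in>A N. c N n * \<xi> n \<omega>)" for N
    using m by measurable
  show "vanishes_in_prob (\<lambda>N \<omega>. \<Sum>n\<in>A N. c N n * \<xi> n \<omega>)" if "(\<lambda>N. \<Sum>n\<in>A N. (c N n)\<^sup>2) \<longlonglongrightarrow> 0"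
  proof (rule vanishes_in_probI_L2[OF mm ort(1)])
    show "(\<lambda>N. expectation (\<lambda>\<omega>. (\<Sum>n\<in>A N. c N n * \<xi> n \<omega>)\<^sup>2)) \<longlonglongrightarrow> 0"
      unfolding ort(2) using tendsto_mult_left[OF that, of v] by simp
  qed
  have "0 \<le> expectation (\<lambda>\<omega>. \<xi> 0 \<omega> * \<xi> 0 \<omega>)" by (rule Bochner_Integration.integral_nonneg) simp
  then have "v \<ge> 0" by (simp add: cov)
  show "bounded_in_prob (\<lambda>N \<omega>. \<Sum>n\<in>A N. c N n * \<xi> n \<omega>)" if "\<And>N. (\<Sum>n\<in>A N. (c N n)\<^sup>2) \<le> 1"
  proof (rule bounded_in_probI_L2[OF mm ort(1)])
    show "expectation (\<lambda>\<omega>. (\<Sum>n\<in>A N. c N n * \<xi> n \<omega>)\<^sup>2) \<le> v" for N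
      unfolding ort(2) using mult_left_mono[OF that \<open>v \<ge> 0\<close>, of N] by simp
  qed
qed

context iid_sequence
begin

text \<open>Formulated for a square integrable \<phi> because it serves both the standardized
  functions and the centered squares a^2 - 1.\<close>

lemma centered_orthogonal:
  assumes [measurable]: "\<phi> \<in> borel_measurable borel" and sq: "integrable M (\<lambda>\<omega>. (\<phi> (Z 0 \<omega>))\<^sup>2)"
    and mean: "expectation (\<lambda>\<omega>. \<phi> (Z 0 \<omega>)) = (0::real)"
  shows "integrable M (\<lambda>\<omega>. \<phi> (Z k \<omega>) * \<phi> (Z l \<omega>))"
    and "expectation (\<lambda>\<omega>. \<phi> (Z k \<omega>) * \<phi> (Z l \<omega>)) = (if k = l then expectation (\<lambda>\<omega>. (\<phi> (Z 0 \<omega>))\<^sup>2) else 0)"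
proof -
  have i: "integrable M (\<lambda>\<omega>. \<phi> (Z 0 \<omega>))"
    by (rule square_integrable_imp_integrable[OF _ sq]) simp
  have "integrable M (\<lambda>\<omega>. (\<phi> (Z k \<omega>))\<^sup>2)"
    using integrable_Z[of "\<lambda>x. (\<phi> x)\<^sup>2" k] sq by simp
  then show "integrable M (\<lambda>\<omega>. \<phi> (Z k \<omega>) * \<phi> (Z l \<omega>))"
    using expectation_mult_distinct(2)[OF assms(1) assms(1) _ i i, of k l]
    by (cases "k = l") (auto simp: power2_eq_square)
  show "expectation (\<lambda>\<omega>. \<phi> (Z k \<omega>) * \<phi> (Z l \<omega>)) = (if k = l then expectation (\<lambda>\<omega>. (\<phi> (Z 0 \<omega>))\<^sup>2) else 0)"
  proof (cases "k = l")
    case True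
    then show ?thesis
      using expectation_Z[of "\<lambda>x. \<phi> x * \<phi> x" k] by (simp add: power2_eq_square)
  next
    case False
    then show ?thesis
      using expectation_mult_distinct(1)[OF assms(1) assms(1) False i i] by (simp add: mean)
  qed
qed

lemma standardized_orthogonal:
  assumes "standardized a"
  shows "integrable M (\<lambda>\<omega>. a (Z k \<omega>) * a (Z l \<omega>))"
    and "expectation (\<lambda>\<omega>. a (Z k \<omega>) * a (Z l \<omega>)) = (if k = l then 1 else 0)"
    and "random_variable borel (\<lambda>\<omega>. a (Z k \<omega>))"
proof -
  have a[measurable]: "a \<in> borel_measurable borel"
    using assms by (simp add: standardized_def fourth_moment_def)
  have "integrable M (\<lambda>\<omega>. (a (Z 0 \<omega>))\<^sup>2)"
    using assms integrable_mult2[of a a 0 0] by (simp add: standardized_def power2_eq_square)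
  from centered_orthogonal[OF a this] assms
  show "integrable M (\<lambda>\<omega>. a (Z k \<omega>) * a (Z l \<omega>))"
    "expectation (\<lambda>\<omega>. a (Z k \<omega>) * a (Z l \<omega>)) = (if k = l then 1 else 0)"
    by (auto simp: standardized_def)
  show "random_variable borel (\<lambda>\<omega>. a (Z k \<omega>))" by measurable
qed

text \<open>Weights 1 / N and 1 / sqrt N. Both rates are wanted: in sqrt N times a product of two
  means, one factor absorbs sqrt N and stays bounded while the other vanishes.\<close>

lemma hat_m_vanishes:
  assumes "standardized a"
  shows "vanishes_in_prob (\<lambda>N \<omega>. hat_m N a (\<lambda>n. X n \<omega>))"
    and "bounded_in_prob (\<lambda>N \<omega>. sqrt (real N) * hat_m N a (\<lambda>n. X n \<omega>))"
proof -
  note ort = standardized_orthogonal[OF assms]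
  have "vanishes_in_prob (\<lambda>N \<omega>. \<Sum>n<N. (1 / real N) * a (Z n \<omega>))"
  proof (rule orthogonal_sum_vanishes[OF ort])
    have "(\<lambda>N. \<Sum>n<N. (1 / real N)\<^sup>2) = (\<lambda>N. 1 / real N)"
      by (auto simp: fun_eq_iff power2_eq_square)
    then show "(\<lambda>N. \<Sum>n<N. (1 / real N)\<^sup>2) \<longlonglongrightarrow> 0" by (simp add: lim_1_over_n)
  qed simp
  then show "vanishes_in_prob (\<lambda>N \<omega>. hat_m N a (\<lambda>n. X n \<omega>))"
    by (simp add: hat_m_eq sum_divide_distrib)
  have "bounded_in_prob (\<lambda>N \<omega>. \<Sum>n<N. (1 / sqrt (real N)) * a (Z n \<omega>))"
    by (rule orthogonal_sum_bounded[OF ort]) (auto simp: power_divide)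
  moreover have "(\<Sum>n<N. (1 / sqrt (real N)) * a (Z n \<omega>)) = sqrt (real N) * hat_m N a (\<lambda>n. X n \<omega>)" for N \<omega>
    using real_sqrt_mult_self[of N]
    by (cases "N = 0") (simp_all add: hat_m_eq sum_divide_distrib[symmetric] field_simps del: real_sqrt_mult_self)
  ultimately show "bounded_in_prob (\<lambda>N \<omega>. sqrt (real N) * hat_m N a (\<lambda>n. X n \<omega>))" by simp
qed

text \<open>The terms reach X (N + k), beyond the sample. In exchange the index range is the same
  for every lag.\<close>

definition lag_sum :: "nat \<Rightarrow> (real \<Rightarrow> real) \<Rightarrow> (real \<Rightarrow> real) \<Rightarrow> nat \<Rightarrow> 'a \<Rightarrow> real" where
  "lag_sum k a b N \<omega> = (\<Sum>n<N. a (Z n \<omega>) * b (Z (n + k) \<omega>)) / sqrt (real N)"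

text \<open>The error is a reweighting of the lag products plus three centering terms, each a
  vanishing mean times a mean scaled by sqrt N that stays bounded.\<close>

lemma hat_gamma_approx:
  assumes a: "standardized a" and b: "standardized b" and k: "k \<ge> 1"
  shows "vanishes_in_prob (\<lambda>N \<omega>. sqrt (real N) * hat_gamma N k a b (\<lambda>n. X n \<omega>) - lag_sum k a b N \<omega>)"
    and "bounded_in_prob (lag_sum k a b)"
proof -
  note orta = standardized_orthogonal[OF a] and ortb = standardized_orthogonal[OF b]
  note [measurable] = orta(3) ortb(3)
  define \<xi> where "\<xi> = (\<lambda>n \<omega>. a (Z n \<omega>) * b (Z (n + k) \<omega>))"
  have ort: "integrable M (\<lambda>\<omega>. \<xi> n \<omega> * \<xi> l \<omega>)"
    "expectation (\<lambda>\<omega>. \<xi> n \<omega> * \<xi> l \<omega>) = (if n = l then 1 else 0)"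
    "random_variable borel (\<xi> n)" for n l
    unfolding \<xi>_def
    using lag_product_integrable[OF a b a b, of n k l k] lag_product_covariance[OF a b a b k k, of n l]
      orta(2)[of 0 0] ortb(2)[of 0 0] by (auto simp del: One_nat_def)
  have bdd: "bounded_in_prob (\<lambda>N \<omega>. \<Sum>n<N. (1 / sqrt (real N)) * \<xi> n \<omega>)"
    by (rule orthogonal_sum_bounded[OF ort]) (auto simp: power_divide)
  have lag: "lag_sum k a b N \<omega> = (\<Sum>n<N. (1 / sqrt (real N)) * \<xi> n \<omega>)" for N \<omega>
    by (simp add: lag_sum_def \<xi>_def sum_divide_distrib)
  show "bounded_in_prob (lag_sum k a b)"
    using bdd unfolding lag[symmetric] .
  \<comment> \<open>Weight in the autocovariance minus weight in the lag sum; the last k terms occur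
    in the lag sum only. For N > k the squares add up to k / (N - k).\<close>
  define c where "c = (\<lambda>N n. (if n < N - k then sqrt (real N) / real (N - k) else 0) - 1 / sqrt (real N))"
  have lim: "(\<lambda>N. 1 / real (N - k)) \<longlonglongrightarrow> 0"
    by (rule LIMSEQ_offset[of _ k]) (simp add: lim_1_over_n)
  have c2: "(\<Sum>n<N. (c N n)\<^sup>2) = real k / real (N - k)" if "N > k" for N
  proof -
    define d where "d = real (N - k)"
    have d: "d > 0" "real N = d + k" using that by (auto simp: d_def of_nat_diff)
    have split: "{..<N} = {..<N-k} \<union> {N-k..<N}" using that by auto
    have "(\<Sum>n<N. (c N n)\<^sup>2) = (\<Sum>n<N-k. (c N n)\<^sup>2) + (\<Sum>n\<in>{N-k..<N}. (c N n)\<^sup>2)"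
      unfolding split by (rule sum.union_disjoint) auto
    also have "(\<Sum>n<N-k. (c N n)\<^sup>2) = d * (sqrt (real N) / d - 1 / sqrt (real N))\<^sup>2"
      using that by (simp add: c_def d_def of_nat_diff)
    also have "(\<Sum>n\<in>{N-k..<N}. (c N n)\<^sup>2) = real k * (1 / real N)"
      using that by (simp add: c_def power_divide)
    also have "(sqrt (real N) / d - 1 / sqrt (real N))\<^sup>2 = real N / d\<^sup>2 - 2 / d + 1 / real N"
      using that d by (simp add: power2_diff power_divide)
    also have "d * (real N / d\<^sup>2 - 2 / d + 1 / real N) + real k * (1 / real N) = real k / d"
    proof -
      have "d * (real N / d\<^sup>2 - 2 / d + 1 / real N) = real N / d - 2 + d / real N"
        using d(1) by (simp add: algebra_simps power2_eq_square)
      moreover have "d / real N + real k * (1 / real N) = 1"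
        using d by (simp add: add_divide_distrib[symmetric])
      moreover have "real N / d = 1 + real k / d"
        using d by (simp add: add_divide_distrib)
      ultimately show ?thesis by simp
    qed
    finally show ?thesis by (simp add: d_def)
  qed
  have T: "vanishes_in_prob (\<lambda>N \<omega>. \<Sum>n<N. c N n * \<xi> n \<omega>)"
  proof (rule orthogonal_sum_vanishes[OF ort])
    have "(\<lambda>N. real k / real (N - k)) \<longlonglongrightarrow> 0"
      using tendsto_mult_left[OF lim, of "real k"] by simp
    then show "(\<lambda>N. \<Sum>n<N. (c N n)\<^sup>2) \<longlonglongrightarrow> 0"
      by (rule Lim_transform_eventually)
        (use eventually_gt_at_top[of k] in \<open>eventually_elim, simp add: c2\<close>)
  qed simp
  have sq: "real j * (1 / real j)\<^sup>2 = 1 / real j" for j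
    by (simp add: power2_eq_square)
  have P: "vanishes_in_prob (\<lambda>N \<omega>. \<Sum>n<N-k. (1 / real (N - k)) * a (Z n \<omega>))"
  proof (rule orthogonal_sum_vanishes[OF orta])
    show "(\<lambda>N. \<Sum>n<N-k. (1 / real (N - k))\<^sup>2) \<longlonglongrightarrow> 0"
      unfolding sum_constant card_lessThan card_atLeastLessThan sq by (rule lim)
  qed simp
  \<comment> \<open>The second factor is shifted by the lag, so its partial mean runs over k \<le> n
    < N.\<close>
  have Q: "vanishes_in_prob (\<lambda>N \<omega>. \<Sum>n\<in>{k..<N}. (1 / real (N - k)) * b (Z n \<omega>))"
  proof (rule orthogonal_sum_vanishes[OF ortb])
    show "(\<lambda>N. \<Sum>n\<in>{k..<N}. (1 / real (N - k))\<^sup>2) \<longlonglongrightarrow> 0"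
      unfolding sum_constant card_lessThan card_atLeastLessThan sq by (rule lim)
  qed simp
  \<comment> \<open>For N > k this is exactly the error, arranged so that in each centering term
    sqrt N stands with a full sample mean.\<close>
  define E where "E = (\<lambda>N \<omega>. (\<Sum>n<N. c N n * \<xi> n \<omega>)
      - (\<Sum>n<N-k. (1 / real (N - k)) * a (Z n \<omega>)) * (sqrt (real N) * hat_m N b (\<lambda>n. X n \<omega>))
      - (\<Sum>n\<in>{k..<N}. (1 / real (N - k)) * b (Z n \<omega>)) * (sqrt (real N) * hat_m N a (\<lambda>n. X n \<omega>))
      + hat_m N b (\<lambda>n. X n \<omega>) * (sqrt (real N) * hat_m N a (\<lambda>n. X n \<omega>)))"
  have "vanishes_in_prob E"
    unfolding E_def
    by (intro vanishes_in_prob_add vanishes_in_prob_diff vanishes_in_prob_mult T P Q hat_m_vanishes a b)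
  moreover have "sqrt (real N) * hat_gamma N k a b (\<lambda>n. X n \<omega>) - lag_sum k a b N \<omega> = E N \<omega>" if "N > k" for N \<omega>
  proof -
    have 1: "(\<Sum>n\<in>{k..<N}. (1 / real (N - k)) * b (Z n \<omega>)) = (\<Sum>n<N-k. b (Z (n + k) \<omega>)) / real (N - k)"
      using that sum.shift_bounds_nat_ivl[of "\<lambda>n. b (Z n \<omega>)" 0 k "N - k"]
      by (simp add: sum_divide_distrib[symmetric] atLeast0LessThan)
    have "(\<Sum>n<N. if n < N - k then \<xi> n \<omega> else 0) = (\<Sum>n<N-k. \<xi> n \<omega>)"
      using that by (subst sum.inter_filter[symmetric]) (auto intro!: sum.cong)
    then have "(\<Sum>n<N. (if n < N - k then sqrt (real N) / real (N - k) else 0) * \<xi> n \<omega>)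
       = sqrt (real N) / real (N - k) * (\<Sum>n<N-k. \<xi> n \<omega>)"
      by (simp add: sum_distrib_left if_distrib[of "\<lambda>u. _ * u"] if_distrib[of "\<lambda>u. u * _"] cong: if_cong)
        (auto simp: sum_distrib_left intro!: sum.mono_neutral_cong_right split: if_splits)
    then have 2: "(\<Sum>n<N. c N n * \<xi> n \<omega>) = sqrt (real N) * ((\<Sum>n<N-k. \<xi> n \<omega>) / real (N - k)) - lag_sum k a b N \<omega>"
      by (simp add: c_def lag left_diff_distrib sum_subtractf)
    show ?thesis
      unfolding E_def 1 2 unfolding hat_gamma_eq[OF that] \<xi>_def
      by (simp add: sum_divide_distrib[symmetric] algebra_simps del: of_nat_diff)
  qed
  moreover have "random_variable borel (\<lambda>\<omega>. sqrt (real N) * hat_gamma N k a b (\<lambda>n. X n \<omega>) - lag_sum k a b N \<omega>)" for N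
    by (simp add: hat_gamma_def hat_m_eq lag_sum_def sum.atLeast1_atMost_eq)
  ultimately show "vanishes_in_prob (\<lambda>N \<omega>. sqrt (real N) * hat_gamma N k a b (\<lambda>n. X n \<omega>) - lag_sum k a b N \<omega>)"
    by (elim vanishes_in_prob_cong) (auto intro: eventually_mono[OF eventually_gt_at_top[of k]])
qed

text \<open>The weak law for a^2 - 1, whose variance is finite by the fourth moment, together with
  the vanishing squared sample mean gives consistency of the sample variance; continuous mapping
  does the rest.\<close>

lemma inverse_hat_s_consistent:
  assumes "standardized a"
  shows "vanishes_in_prob (\<lambda>N \<omega>. inverse (hat_s N a (\<lambda>n. X n \<omega>)) - 1)"
proof -
  have a[measurable]: "a \<in> borel_measurable borel" and four: "integrable M (\<lambda>\<omega>. (a (Z 0 \<omega>)) ^ 4)"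
    and one: "expectation (\<lambda>\<omega>. (a (Z 0 \<omega>))\<^sup>2) = 1"
    using assms by (auto simp: standardized_def fourth_moment_def)
  define \<phi> where "\<phi> = (\<lambda>x. (a x)\<^sup>2 - 1)"
  have [measurable]: "\<phi> \<in> borel_measurable borel" by (simp add: \<phi>_def)
  have sq: "integrable M (\<lambda>\<omega>. (a (Z 0 \<omega>))\<^sup>2)"
    using standardized_orthogonal(1)[OF assms, of 0 0] by (simp add: power2_eq_square)
  have "(\<phi> x)\<^sup>2 = (a x) ^ 4 - 2 * (a x)\<^sup>2 + 1" for x
    by (simp add: \<phi>_def power2_diff)
  then have "integrable M (\<lambda>\<omega>. (\<phi> (Z 0 \<omega>))\<^sup>2)" using four sq by simp
  moreover have "expectation (\<lambda>\<omega>. \<phi> (Z 0 \<omega>)) = 0" using sq one by (simp add: \<phi>_def prob_space)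
  ultimately have ort: "integrable M (\<lambda>\<omega>. \<phi> (Z k \<omega>) * \<phi> (Z l \<omega>))"
    "expectation (\<lambda>\<omega>. \<phi> (Z k \<omega>) * \<phi> (Z l \<omega>)) = (if k = l then expectation (\<lambda>\<omega>. (\<phi> (Z 0 \<omega>))\<^sup>2) else 0)"
    "random_variable borel (\<lambda>\<omega>. \<phi> (Z k \<omega>))" for k l
    using centered_orthogonal[of \<phi>] by auto
  have "vanishes_in_prob (\<lambda>N \<omega>. \<Sum>n<N. (1 / real N) * \<phi> (Z n \<omega>))"
  proof (rule orthogonal_sum_vanishes[OF ort])
    have "(\<lambda>N. \<Sum>n<N. (1 / real N)\<^sup>2) = (\<lambda>N. 1 / real N)"
      by (auto simp: fun_eq_iff power2_eq_square)
    then show "(\<lambda>N. \<Sum>n<N. (1 / real N)\<^sup>2) \<longlonglongrightarrow> 0" by (simp add: lim_1_over_n)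
  qed simp
  then have van: "vanishes_in_prob (\<lambda>N \<omega>. (\<Sum>n<N. (1 / real N) * \<phi> (Z n \<omega>))
      - hat_m N a (\<lambda>n. X n \<omega>) * hat_m N a (\<lambda>n. X n \<omega>))"
    by (intro vanishes_in_prob_diff vanishes_in_prob_mult vanishes_in_prob_bounded hat_m_vanishes assms)
  have m: "random_variable borel (\<lambda>\<omega>. hat_s2 N a (\<lambda>n. X n \<omega>))" for N
    by (simp add: hat_s2_def hat_m_eq sum.atLeast1_atMost_eq)
  have "hat_s2 N a (\<lambda>n. X n \<omega>) - 1 = (\<Sum>n<N. (1 / real N) * \<phi> (Z n \<omega>))
      - hat_m N a (\<lambda>n. X n \<omega>) * hat_m N a (\<lambda>n. X n \<omega>)" if "N > 0" for N \<omega>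
    using that by (simp add: hat_s2_eq \<phi>_def sum_subtractf sum_divide_distrib[symmetric] diff_divide_distrib power2_eq_square)
  then have "vanishes_in_prob (\<lambda>N \<omega>. hat_s2 N a (\<lambda>n. X n \<omega>) - 1)"
    using m by (intro vanishes_in_prob_cong[OF van] eventually_mono[OF eventually_gt_at_top[of 0]]) auto
  moreover have "isCont (\<lambda>u::real. inverse (sqrt u)) 1"
    by (auto intro!: continuous_intros)
  ultimately show ?thesis
    using vanishes_in_prob_isCont[of "\<lambda>N \<omega>. hat_s2 N a (\<lambda>n. X n \<omega>)" 1 "\<lambda>u. inverse (sqrt u)"] m
    by (simp add: hat_s_def)
qed

text \<open>With G the scaled autocovariance, U the lag sum and A, B the inverse deviations, G A B -
  U = (G - U) A B + (A B - 1) U, and each summand is a vanishing factor times a bounded one.\<close>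

lemma hat_rho_approx:
  assumes a: "standardized a" and b: "standardized b" and k: "k \<ge> 1"
  shows "vanishes_in_prob (\<lambda>N \<omega>. sqrt (real N) * hat_rho N k a b (\<lambda>n. X n \<omega>) - lag_sum k a b N \<omega>)"
proof -
  define G where "G = (\<lambda>N \<omega>. sqrt (real N) * hat_gamma N k a b (\<lambda>n. X n \<omega>))"
  define A where "A = (\<lambda>N \<omega>. inverse (hat_s N a (\<lambda>n. X n \<omega>)))"
  define B where "B = (\<lambda>N \<omega>. inverse (hat_s N b (\<lambda>n. X n \<omega>)))"
  define U where "U = lag_sum k a b"
  have A: "vanishes_in_prob (\<lambda>N \<omega>. A N \<omega> - 1)" and B: "vanishes_in_prob (\<lambda>N \<omega>. B N \<omega> - 1)"
    unfolding A_def B_def by (intro inverse_hat_s_consistent a b)+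
  have GU: "vanishes_in_prob (\<lambda>N \<omega>. G N \<omega> - U N \<omega>)" and U: "bounded_in_prob U"
    unfolding G_def U_def by (intro hat_gamma_approx a b k)+
  have bounded: "bounded_in_prob Y" if "vanishes_in_prob (\<lambda>N \<omega>. Y N \<omega> - 1)" for Y
    using bounded_in_prob_add[OF vanishes_in_prob_bounded[OF that] bounded_in_prob_const_real[of 1]] by simp
  have "vanishes_in_prob (\<lambda>N \<omega>. (A N \<omega> - 1) * B N \<omega> + (B N \<omega> - 1))"
    by (intro vanishes_in_prob_add vanishes_in_prob_mult A B bounded)
  then have AB: "vanishes_in_prob (\<lambda>N \<omega>. A N \<omega> * B N \<omega> - 1)"
    by (simp add: algebra_simps)
  have "vanishes_in_prob (\<lambda>N \<omega>. (G N \<omega> - U N \<omega>) * (A N \<omega> * B N \<omega>) + (A N \<omega> * B N \<omega> - 1) * U N \<omega>)"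
    by (intro vanishes_in_prob_add vanishes_in_prob_mult AB GU U bounded)
  \<comment> \<open>The inverse of 0 is 0, so the default value of \<open>hat_rho\<close> agrees
    with the product G A B and no exceptional event has to be removed.\<close>
  moreover have "(G N \<omega> - U N \<omega>) * (A N \<omega> * B N \<omega>) + (A N \<omega> * B N \<omega> - 1) * U N \<omega>
      = sqrt (real N) * hat_rho N k a b (\<lambda>n. X n \<omega>) - lag_sum k a b N \<omega>" for N \<omega>
    by (simp add: hat_rho_def G_def U_def A_def B_def algebra_simps divide_inverse)
  ultimately show ?thesis by simp
qed

end

section \<open>Standardization and the joint limit\<close>

lemma hat_m_affine:
  assumes "N > 0"
  shows "hat_m N (\<lambda>u. (f u - c) / s) x = (hat_m N f x - c) / s"
  using assms by (simp add: hat_m_eq sum_divide_distrib[symmetric] sum_subtractf field_simps)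

text \<open>Shifts cancel in the deviations and scales in the quotient. Positive scales leave the
  sign alone and preserve whether a denominator vanishes, so the default case is matched
  too.\<close>

lemma hat_rho_affine:
  assumes "N > 0" "s > 0" "t > 0"
  shows "hat_rho N k (\<lambda>u. (f u - c) / s) (\<lambda>u. (g u - d) / t) x = hat_rho N k f g x"
proof -
  have diff: "(f (x i) - c) / s - hat_m N (\<lambda>u. (f u - c) / s) x = (f (x i) - hat_m N f x) / s" for f c s i
    unfolding hat_m_affine[OF assms(1)] by (simp add: diff_divide_distrib)
  have s: "hat_s N (\<lambda>u. (f u - c) / s) x = hat_s N f x / s" if "s > 0" for f c s
    using that
    by (simp add: hat_s_def hat_s2_def diff power_divide sum_divide_distrib[symmetric] real_sqrt_divide real_sqrt_mult)
  have g: "hat_gamma N k (\<lambda>u. (f u - c) / s) (\<lambda>u. (g u - d) / t) x = hat_gamma N k f g x / (s * t)"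
    by (simp add: hat_gamma_def diff sum_divide_distrib[symmetric])
  show ?thesis
    using assms by (simp add: hat_rho_def s g)
qed

text \<open>Independence over k turns the expectation into a product, so the exponents add up: the
  joint covariance is block diagonal with one copy of \<open>S\<close> for each k.\<close>

lemma iid_gaussian_char:
  fixes \<mu> :: "('i::countable \<Rightarrow> real) measure"
  assumes \<mu>: "centered_gaussian \<mu> I S" and J: "finite J"
  shows "(\<integral>\<omega>. cis (\<Sum>k\<in>J. \<Sum>p\<in>I. t k p * \<omega> k p) \<partial>PiM UNIV (\<lambda>_::nat. \<mu>))
    = complex_of_real (exp (- (\<Sum>k\<in>J. \<Sum>p\<in>I. \<Sum>q\<in>I. t k p * S p q * t k q) / 2))"
proof -
  have "prob_space \<mu>" and sets: "sets \<mu> = sets borel"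
    and char: "\<And>t. (\<integral>x. cis (\<Sum>p\<in>I. t p * x p) \<partial>\<mu>) = complex_of_real (exp (- (\<Sum>p\<in>I. \<Sum>q\<in>I. t p * S p q * t q) / 2))"
    using \<mu> by (auto simp: centered_gaussian_def)
  define P where "P = PiM UNIV (\<lambda>_::nat. \<mu>)"
  interpret P: prob_space P unfolding P_def by (rule prob_space_PiM[OF \<open>prob_space \<mu>\<close>])
  have ind: "P.indep_vars (\<lambda>_. borel) (\<lambda>k \<omega>. \<omega> k) UNIV"
    unfolding P_def by (rule indep_vars_PiM_coordinates[OF \<open>prob_space \<mu>\<close> sets])
  have m: "(\<lambda>\<omega>. \<omega> k) \<in> measurable P borel" for k
    using ind by (auto simp: P.indep_vars_def)
  have distr: "distr P borel (\<lambda>\<omega>. \<omega> k) = \<mu>" for k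
    using distr_PiM_component[of UNIV "\<lambda>_. \<mu>" k] \<open>prob_space \<mu>\<close>
      distr_cong[OF refl sets refl, of P "\<lambda>\<omega>. \<omega> k"]
    unfolding P_def by simp
  have lin: "(\<lambda>x. \<Sum>p\<in>I. t k p * x p) \<in> borel_measurable borel" for k by measurable
  have "(\<integral>\<omega>. cis (\<Sum>k\<in>J. \<Sum>p\<in>I. t k p * \<omega> k p) \<partial>P) = (\<Prod>k\<in>J. \<integral>\<omega>. cis (\<Sum>p\<in>I. t k p * \<omega> k p) \<partial>P)"
  proof (rule P.integral_cis_sum_indep)
    show "P.indep_vars (\<lambda>_. borel) (\<lambda>k \<omega>. \<Sum>p\<in>I. t k p * \<omega> k p) J"
      by (rule P.indep_vars_compose2[OF P.indep_vars_subset[OF ind], where Y="\<lambda>k x. \<Sum>p\<in>I. t k p * x p"])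
        (auto intro: lin)
  qed
  also have "\<dots> = (\<Prod>k\<in>J. \<integral>x. cis (\<Sum>p\<in>I. t k p * x p) \<partial>\<mu>)"
  proof (rule prod.cong[OF refl])
    fix k
    have "(\<lambda>x. cis (\<Sum>p\<in>I. t k p * x p)) \<in> borel_measurable borel"
      unfolding cis_conv_exp using lin[of k] by measurable
    from integral_distr[OF m[of k] this]
    show "(\<integral>\<omega>. cis (\<Sum>p\<in>I. t k p * \<omega> k p) \<partial>P) = (\<integral>x. cis (\<Sum>p\<in>I. t k p * x p) \<partial>\<mu>)"
      by (simp add: distr)
  qed
  also have "\<dots> = complex_of_real (exp (\<Sum>k\<in>J. - (\<Sum>p\<in>I. \<Sum>q\<in>I. t k p * S p q * t k q) / 2))"
    unfolding char by (simp add: exp_sum J)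
  also have "(\<Sum>k\<in>J. - (\<Sum>p\<in>I. \<Sum>q\<in>I. t k p * S p q * t k q) / 2)
      = - (\<Sum>k\<in>J. \<Sum>p\<in>I. \<Sum>q\<in>I. t k p * S p q * t k q) / 2"
    by (simp add: sum_negf sum_divide_distrib)
  finally show ?thesis by (simp add: P_def)
qed

context iid_sequence
begin

text \<open>Bilinear expansion over \<open>D\<close>. The matrix \<Gamma> records that products with
  different lags are uncorrelated, which becomes independence over the lags in the limit.\<close>

lemma lag_form_covariance:
  fixes A B :: "'i \<Rightarrow> real \<Rightarrow> real" and \<kappa> :: "'i \<Rightarrow> nat" and t :: "'i \<Rightarrow> real"
  assumes st: "\<And>p. p \<in> D \<Longrightarrow> standardized (A p)" "\<And>p. p \<in> D \<Longrightarrow> standardized (B p)" "\<And>p. p \<in> D \<Longrightarrow> \<kappa> p \<ge> 1"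
  defines "\<xi> \<equiv> \<lambda>n \<omega>. \<Sum>p\<in>D. t p * (A p (Z n \<omega>) * B p (Z (n + \<kappa> p) \<omega>))"
    and "\<Gamma> \<equiv> \<lambda>p q. if \<kappa> p = \<kappa> q then expectation (\<lambda>\<omega>. A p (Z 0 \<omega>) * A q (Z 0 \<omega>)) * expectation (\<lambda>\<omega>. B p (Z 0 \<omega>) * B q (Z 0 \<omega>)) else 0"
  shows "integrable M (\<lambda>\<omega>. \<xi> n \<omega> * \<xi> l \<omega>)"
    and "expectation (\<lambda>\<omega>. \<xi> n \<omega> * \<xi> l \<omega>) = (if n = l then \<Sum>p\<in>D. \<Sum>q\<in>D. t p * \<Gamma> p q * t q else 0)"
    and "expectation (\<xi> n) = 0"
proof -
  define \<eta> where "\<eta> = (\<lambda>p n \<omega>. A p (Z n \<omega>) * B p (Z (n + \<kappa> p) \<omega>))"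
  have eq: "\<xi> n \<omega> * \<xi> l \<omega> = (\<Sum>p\<in>D. \<Sum>q\<in>D. t p * t q * (\<eta> p n \<omega> * \<eta> q l \<omega>))" for \<omega>
    unfolding \<xi>_def \<eta>_def sum_product by (intro sum.cong refl) (simp only: mult_ac)
  have i: "integrable M (\<lambda>\<omega>. \<eta> p n \<omega> * \<eta> q l \<omega>)" if "p \<in> D" "q \<in> D" for p q
    unfolding \<eta>_def using that by (intro lag_product_integrable st)
  have e: "expectation (\<lambda>\<omega>. \<eta> p n \<omega> * \<eta> q l \<omega>) = (if n = l then \<Gamma> p q else 0)" if "p \<in> D" "q \<in> D" for p q
    unfolding \<eta>_def \<Gamma>_def using that st(3)[of p] st(3)[of q]
    by (subst lag_product_covariance) (auto intro: st(1,2))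
  show "integrable M (\<lambda>\<omega>. \<xi> n \<omega> * \<xi> l \<omega>)"
    unfolding eq using i by auto
  have "expectation (\<lambda>\<omega>. \<xi> n \<omega> * \<xi> l \<omega>) = (\<Sum>p\<in>D. \<Sum>q\<in>D. t p * t q * (if n = l then \<Gamma> p q else 0))"
    unfolding eq using i e by (simp add: Bochner_Integration.integral_sum)
  then show "expectation (\<lambda>\<omega>. \<xi> n \<omega> * \<xi> l \<omega>) = (if n = l then \<Sum>p\<in>D. \<Sum>q\<in>D. t p * \<Gamma> p q * t q else 0)"
    by (simp add: mult_ac)
  have "integrable M (\<lambda>\<omega>. A p (Z n \<omega>) * B p (Z (n + \<kappa> p) \<omega>))" if "p \<in> D" for p
    using that st by (intro integrable_mult2) (auto simp: standardized_def)
  then show "expectation (\<xi> n) = 0"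
    unfolding \<xi>_def using lag_product_mean[OF st(1,2,3)] by (simp add: Bochner_Integration.integral_sum)
qed

text \<open>A linear combination of lag sums is the sum along n of a single function of the window Z
  n, ..., Z (n + K), which is wide enough for every lag. The scalar theorem then applies with the
  quadratic form of \<Gamma> as variance.\<close>

lemma lag_sums_clt:
  fixes A B :: "'i \<Rightarrow> real \<Rightarrow> real" and \<kappa> :: "'i \<Rightarrow> nat" and t :: "'i \<Rightarrow> real"
  assumes st: "\<And>p. p \<in> D \<Longrightarrow> standardized (A p)" "\<And>p. p \<in> D \<Longrightarrow> standardized (B p)"
    "\<And>p. p \<in> D \<Longrightarrow> \<kappa> p \<ge> 1" "\<And>p. p \<in> D \<Longrightarrow> \<kappa> p \<le> K"
  defines "\<Gamma> \<equiv> \<lambda>p q. if \<kappa> p = \<kappa> q then expectation (\<lambda>\<omega>. A p (Z 0 \<omega>) * A q (Z 0 \<omega>)) * expectation (\<lambda>\<omega>. B p (Z 0 \<omega>) * B q (Z 0 \<omega>)) else 0"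
  shows "(\<lambda>N. \<integral>\<omega>. cis (\<Sum>p\<in>D. t p * lag_sum (\<kappa> p) (A p) (B p) N \<omega>) \<partial>M)
    \<longlonglongrightarrow> complex_of_real (exp (- (\<Sum>p\<in>D. \<Sum>q\<in>D. t p * \<Gamma> p q * t q) / 2))"
proof -
  define h where "h = (\<lambda>y. \<Sum>p\<in>D. t p * (A p (y 0) * B p (y (\<kappa> p))))"
  define \<xi> where "\<xi> = (\<lambda>n \<omega>. \<Sum>p\<in>D. t p * (A p (Z n \<omega>) * B p (Z (n + \<kappa> p) \<omega>)))"
  have cov: "integrable M (\<lambda>\<omega>. \<xi> n \<omega> * \<xi> l \<omega>)"
    "expectation (\<lambda>\<omega>. \<xi> n \<omega> * \<xi> l \<omega>) = (if n = l then \<Sum>p\<in>D. \<Sum>q\<in>D. t p * \<Gamma> p q * t q else 0)"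
    "expectation (\<lambda>\<omega>. \<xi> n \<omega>) = 0" for n l
    unfolding \<xi>_def \<Gamma>_def by (intro lag_form_covariance st; assumption)+
  have h: "h (\<lambda>i\<in>{..K}. Z (n + i) \<omega>) = \<xi> n \<omega>" for n \<omega>
    unfolding h_def \<xi>_def using st(4) by (intro sum.cong) auto
  have mh: "h \<in> borel_measurable (PiM {..K} (\<lambda>_. borel))"
    unfolding h_def
  proof (intro borel_measurable_sum borel_measurable_times)
    fix p assume p: "p \<in> D"
    have ms: "A p \<in> borel_measurable borel" "B p \<in> borel_measurable borel"
      using st(1,2)[OF p] by (auto simp: standardized_def fourth_moment_def)
    show "(\<lambda>y. A p (y 0)) \<in> borel_measurable (PiM {..K} (\<lambda>_. borel))"
      by (rule measurable_compose[OF _ ms(1)]) simp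
    show "(\<lambda>y. B p (y (\<kappa> p))) \<in> borel_measurable (PiM {..K} (\<lambda>_. borel))"
      using st(4)[OF p] by (intro measurable_compose[OF _ ms(2)]) simp
  qed simp
  have "(\<lambda>N. \<integral>\<omega>. cis ((\<Sum>n<N. h (\<lambda>i\<in>{..K}. Z (n + i) \<omega>)) / sqrt (real N)) \<partial>M)
    \<longlonglongrightarrow> complex_of_real (exp (- (\<Sum>p\<in>D. \<Sum>q\<in>D. t p * \<Gamma> p q * t q) / 2))"
    by (rule clt_m_dependent[OF indep_Z distr_Z mh]) (unfold h, (rule cov)+)
  moreover have "(\<Sum>n<N. h (\<lambda>i\<in>{..K}. Z (n + i) \<omega>)) / sqrt (real N)
      = (\<Sum>p\<in>D. t p * lag_sum (\<kappa> p) (A p) (B p) N \<omega>)" for N \<omega>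
  proof -
    have "(\<Sum>n<N. \<xi> n \<omega>) = (\<Sum>p\<in>D. \<Sum>n<N. t p * (A p (Z n \<omega>) * B p (Z (n + \<kappa> p) \<omega>)))"
      unfolding \<xi>_def by (rule sum.swap)
    then show ?thesis
      unfolding h by (simp add: lag_sum_def sum_distrib_left sum_divide_distrib)
  qed
  ultimately show ?thesis by simp
qed

section \<open>Reduction to standardized functions\<close>

definition standardize :: "(real \<Rightarrow> real) \<Rightarrow> real \<Rightarrow> real" where
  "standardize g u = (g u - pop_mean M (X 1) g) / sqrt (pop_cov M (X 1) g g)"

lemma standardized_standardize:
  assumes [measurable]: "g \<in> borel_measurable borel" and four: "integrable M (\<lambda>\<omega>. (g (X 1 \<omega>)) ^ 4)"
    and pos: "pop_cov M (X 1) g g > 0"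
  shows "standardized (standardize g)"
proof -
  define c where "c = pop_mean M (X 1) g"
  define s where "s = sqrt (pop_cov M (X 1) g g)"
  have "s > 0" using pos by (simp add: s_def)
  have g: "fourth_moment g" using four by (simp add: fourth_moment_def)
  note one = fourth_moment_const[of 1]
  \<comment> \<open>The binomial expansion is written with products of four factors, padded by 1, to
    match the shape of \<open>integrable_mult4\<close>.\<close>
  have "(g u - c) ^ 4 = g u * g u * g u * g u - 4 * c * (g u * g u * g u * 1) + 6 * c\<^sup>2 * (g u * g u * 1 * 1)
      - 4 * c ^ 3 * (g u * 1 * 1 * 1) + c ^ 4" for u
    by (simp add: power4_eq_xxxx power2_eq_square power3_eq_cube algebra_simps)
  then have "integrable M (\<lambda>\<omega>. (g (Z 0 \<omega>) - c) ^ 4)"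
    using integrable_mult4[OF g g g g, of 0 0 0 0] integrable_mult4[OF g g g one, of 0 0 0]
      integrable_mult4[OF g g one one, of 0 0] integrable_mult1[OF g, of 0] by simp
  then have "fourth_moment (standardize g)"
    by (simp add: fourth_moment_def standardize_def[abs_def] power_divide c_def)
  moreover have "expectation (\<lambda>\<omega>. standardize g (Z 0 \<omega>)) = 0"
    using integrable_mult1[OF g, of 0]
    by (simp add: standardize_def[abs_def] pop_mean_def prob_space)
  moreover have "expectation (\<lambda>\<omega>. (standardize g (Z 0 \<omega>))\<^sup>2) = 1"
    using pos by (simp add: standardize_def[abs_def] power_divide pop_cov_def[of M _ g g] power2_eq_square)
  ultimately show ?thesis by (simp add: standardized_def)
qed

lemma expectation_standardize_mult:
  "expectation (\<lambda>\<omega>. standardize g (Z 0 \<omega>) * standardize h (Z 0 \<omega>)) = pop_corr M (X 1) g h"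
  by (simp add: standardize_def pop_corr_def pop_cov_def[of M _ g h])

lemma measurable_hat_rho:
  assumes [measurable]: "g \<in> borel_measurable borel" "h \<in> borel_measurable borel"
  shows "random_variable borel (\<lambda>\<omega>. hat_rho N k g h (\<lambda>n. X n \<omega>))"
proof -
  have m[measurable]: "random_variable borel (\<lambda>\<omega>. hat_s N u (\<lambda>n. X n \<omega>))" if [measurable]: "u \<in> borel_measurable borel" for u
    by (simp add: hat_s_def hat_s2_def hat_m_eq sum.atLeast1_atMost_eq)
  have [measurable]: "random_variable borel (\<lambda>\<omega>. hat_gamma N k g h (\<lambda>n. X n \<omega>))"
    by (simp add: hat_gamma_def hat_m_eq sum.atLeast1_atMost_eq)
  show ?thesis unfolding hat_rho_def by measurable
qed

lemma hat_rho_standardize_approx: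
  assumes g: "g \<in> borel_measurable borel" "integrable M (\<lambda>\<omega>. (g (X 1 \<omega>)) ^ 4)" "pop_cov M (X 1) g g > 0"
    and h: "h \<in> borel_measurable borel" "integrable M (\<lambda>\<omega>. (h (X 1 \<omega>)) ^ 4)" "pop_cov M (X 1) h h > 0"
    and "k \<ge> 1"
  shows "vanishes_in_prob (\<lambda>N \<omega>. sqrt (real N) * hat_rho N k g h (\<lambda>n. X n \<omega>)
      - lag_sum k (standardize g) (standardize h) N \<omega>)"
proof (rule vanishes_in_prob_cong)
  note st = standardized_standardize[OF g] standardized_standardize[OF h]
  show "vanishes_in_prob (\<lambda>N \<omega>. sqrt (real N) * hat_rho N k (standardize g) (standardize h) (\<lambda>n. X n \<omega>)
      - lag_sum k (standardize g) (standardize h) N \<omega>)"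
    by (rule hat_rho_approx[OF st \<open>k \<ge> 1\<close>])
  show "random_variable borel (\<lambda>\<omega>. sqrt (real N) * hat_rho N k g h (\<lambda>n. X n \<omega>)
      - lag_sum k (standardize g) (standardize h) N \<omega>)" for N
    using bounded_in_prob_measurable[OF hat_gamma_approx(2)[OF st \<open>k \<ge> 1\<close>], of N]
      measurable_hat_rho[OF g(1) h(1), of N k] by simp
  have "hat_rho N k (standardize g) (standardize h) x = hat_rho N k g h x" if "N > 0" for N x
    unfolding standardize_def[abs_def] using g(3) h(3) that by (intro hat_rho_affine) auto
  then show "\<forall>\<^sub>F N in sequentially. \<forall>\<omega>\<in>space M.
      \<bar>sqrt (real N) * hat_rho N k g h (\<lambda>n. X n \<omega>) - lag_sum k (standardize g) (standardize h) N \<omega>\<bar>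
      \<le> \<bar>sqrt (real N) * hat_rho N k (standardize g) (standardize h) (\<lambda>n. X n \<omega>)
          - lag_sum k (standardize g) (standardize h) N \<omega>\<bar>"
    by (auto intro: eventually_mono[OF eventually_gt_at_top[of 0]])
qed

end

text \<open>The quadratic form is the second moment of a linear combination of lag 1 products, hence
  nonnegative. This bypasses the spectral theory of Kronecker products.\<close>

lemma (in iid_sequence) correlation_tensor_psd:
  assumes "finite I" and st: "\<And>i j. (i, j) \<in> I \<Longrightarrow> standardized (a i) \<and> standardized (a j)"
  shows "0 \<le> (\<Sum>p\<in>I. \<Sum>q\<in>I. t p * (case p of (i, j) \<Rightarrow> \<lambda>(i', j').
     expectation (\<lambda>\<omega>. a i (Z 0 \<omega>) * a i' (Z 0 \<omega>)) * expectation (\<lambda>\<omega>. a j (Z 0 \<omega>) * a j' (Z 0 \<omega>))) q * t q)"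
proof -
  define \<xi> where "\<xi> = (\<lambda>n \<omega>. \<Sum>p\<in>I. t p * (a (fst p) (Z n \<omega>) * a (snd p) (Z (n + 1) \<omega>)))"
  have st': "standardized (a (fst p))" "standardized (a (snd p))" if "p \<in> I" for p
    using st[of "fst p" "snd p"] that by auto
  have "0 \<le> expectation (\<lambda>\<omega>. \<xi> 0 \<omega> * \<xi> 0 \<omega>)"
    by (rule Bochner_Integration.integral_nonneg) simp
  also have "\<dots> = (\<Sum>p\<in>I. \<Sum>q\<in>I. t p * (expectation (\<lambda>\<omega>. a (fst p) (Z 0 \<omega>) * a (fst q) (Z 0 \<omega>))
      * expectation (\<lambda>\<omega>. a (snd p) (Z 0 \<omega>) * a (snd q) (Z 0 \<omega>))) * t q)"
    unfolding \<xi>_def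
    by (subst lag_form_covariance(2)[of I "\<lambda>p. a (fst p)" "\<lambda>p. a (snd p)" "\<lambda>_. 1"]) (simp_all add: st')
  finally show ?thesis by (simp add: split_beta)
qed

theorem theorem2:
  fixes M :: "'a measure" and X :: "nat \<Rightarrow> 'a \<Rightarrow> real"
    and f :: "nat \<Rightarrow> real \<Rightarrow> real" and m K :: nat
  assumes "prob_space M"
    and "prob_space.indep_vars M (\<lambda>_. borel) X {1..}"
    and "\<And>i. i \<ge> 1 \<Longrightarrow> distr M borel (X i) = distr M borel (X 1)"
    and "\<And>i. i < m \<Longrightarrow> f i \<in> borel_measurable borel"
    and "\<And>i. i < m \<Longrightarrow> integrable M (\<lambda>\<omega>. (f i (X 1 \<omega>)) ^ 4)"
    and "\<And>i. i < m \<Longrightarrow> pop_cov M (X 1) (f i) (f i) > 0"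
    and "K \<ge> 1"
  shows "\<exists>P :: (nat \<Rightarrow> nat \<times> nat \<Rightarrow> real) measure.
         \<exists>Xi :: nat \<Rightarrow> (nat \<Rightarrow> nat \<times> nat \<Rightarrow> real) \<Rightarrow> (nat \<times> nat \<Rightarrow> real).
           prob_space P \<and>
           prob_space.indep_vars P (\<lambda>_. borel) Xi {1..K} \<and>
           (\<forall>k\<in>{1..K}. centered_gaussian (distr P borel (Xi k)) ({..<m} \<times> {..<m})
              (\<lambda>(i, j) (i', j'). pop_corr M (X 1) (f i) (f i') * pop_corr M (X 1) (f j) (f j'))) \<and>
           conv_distr M
             (\<lambda>N \<omega> (i, j, k). if i < m \<and> j < m \<and> k \<in> {1..K}
                 then sqrt (real N) * hat_rho N k (f i) (f j) (\<lambda>n. X n \<omega>) else 0)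
             (distr P borel (\<lambda>\<omega> (i, j, k). if k \<in> {1..K} then Xi k \<omega> (i, j) else 0))"
proof -
  interpret prob_space M by fact
  interpret iid_sequence M X
    by unfold_locales (fact assms(2), rule assms(3))
  define I where "I = {..<m} \<times> {..<m}"
  \<comment> \<open>Triples are produced from lag and pair, so that a sum over \<open>D\<close>
    splits into one sum over pairs for each lag, matching the block structure of the limit.\<close>
  define D where "D = (\<lambda>(k, i, j). (i, j, k)) ` ({1..K} \<times> I)"
  define a where "a = (\<lambda>i. standardize (f i))"
  define c where "c = (\<lambda>i i'. pop_corr M (X 1) (f i) (f i'))"
  define S where "S = (\<lambda>(i, j) (i', j'). c i i' * c j j')"
  have a: "standardized (a i)" if "i < m" for i
    unfolding a_def using assms(4-6)[OF that] by (intro standardized_standardize)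
  have c: "c i i' = expectation (\<lambda>\<omega>. a i (Z 0 \<omega>) * a i' (Z 0 \<omega>))" for i i'
    by (simp only: c_def a_def expectation_standardize_mult)
  have "finite I" "finite D" by (auto simp: I_def D_def)
  have mem_D: "(i, j, k) \<in> D \<longleftrightarrow> i < m \<and> j < m \<and> k \<in> {1..K}" for i j k
    by (force simp: D_def I_def)
  have sum_D: "(\<Sum>p\<in>D. F p) = (\<Sum>k\<in>{1..K}. \<Sum>p\<in>I. F (fst p, snd p, k))" for F :: "nat \<times> nat \<times> nat \<Rightarrow> real"
  proof -
    have "inj_on (\<lambda>(k, i, j). (i, j, k)) ({1..K} \<times> I)" by (auto simp: inj_on_def)
    then show ?thesis
      unfolding D_def by (subst sum.reindex) (auto simp: sum.cartesian_product split_beta)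
  qed
  have psd: "0 \<le> (\<Sum>p\<in>I. \<Sum>q\<in>I. t p * S p q * t q)" for t
    using correlation_tensor_psd[OF \<open>finite I\<close>, of a t] a unfolding S_def c by (auto simp: I_def)
  have sym: "S p q = S q p" for p q
    by (cases p; cases q) (simp add: S_def c mult.commute)
  obtain \<mu> where \<mu>: "centered_gaussian \<mu> I S"
    using centered_gaussian_exists[OF \<open>finite I\<close> sym psd] .
  then have \<mu>_prob: "prob_space \<mu>" and \<mu>_sets: "sets \<mu> = sets borel"
    and \<mu>_support: "AE x in \<mu>. \<forall>p. p \<notin> I \<longrightarrow> x p = 0"
    by (auto simp: centered_gaussian_def)
  \<comment> \<open>The limit vectors are realized as coordinates of a product of copies of \<mu>,
    which makes them independent with law \<mu> by construction.\<close>
  define P where "P = PiM UNIV (\<lambda>_::nat. \<mu>)"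
  interpret P: prob_space P unfolding P_def by (rule prob_space_PiM[OF \<mu>_prob])
  define Xi where "Xi = (\<lambda>(k::nat) (\<omega>::nat \<Rightarrow> nat \<times> nat \<Rightarrow> real). \<omega> k)"
  have indep: "P.indep_vars (\<lambda>_. borel) Xi UNIV"
    unfolding P_def Xi_def by (rule indep_vars_PiM_coordinates[OF \<mu>_prob \<mu>_sets])
  have m_Xi[measurable]: "Xi k \<in> measurable P borel" for k
    using indep by (auto simp: P.indep_vars_def)
  have m_coord[measurable]: "(\<lambda>\<omega>. Xi k \<omega> p) \<in> borel_measurable P" for k p
    by (rule measurable_compose[OF m_Xi measurable_product_coordinates])
  have distr_Xi: "distr P borel (Xi k) = \<mu>" for k
    using distr_PiM_component[of UNIV "\<lambda>_. \<mu>" k] \<mu>_prob distr_cong[OF refl \<mu>_sets refl, of P "\<lambda>\<omega>. \<omega> k"]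
    unfolding P_def Xi_def by simp
  define V where "V = (\<lambda>\<omega> (i, j, k). if k \<in> {1..K} then Xi k \<omega> (i, j) else 0)"
  define \<nu> where "\<nu> = distr P borel V"
  have m_V[measurable]: "V \<in> borel_measurable P"
  proof (rule measurable_coordinatewise_then_product)
    show "(\<lambda>\<omega>. V \<omega> p) \<in> borel_measurable P" for p
      by (cases p) (auto simp: V_def)
  qed
  define Y where "Y = (\<lambda>N \<omega> (i, j, k). if i < m \<and> j < m \<and> k \<in> {1..K}
      then sqrt (real N) * hat_rho N k (f i) (f j) (\<lambda>n. X n \<omega>) else 0)"
  define U where "U = (\<lambda>N \<omega> p. lag_sum (snd (snd p)) (a (fst p)) (a (fst (snd p))) N \<omega>)"
  have m_Y[measurable]: "(\<lambda>\<omega>. Y N \<omega> p) \<in> borel_measurable M" for N p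
  proof (cases p)
    case (fields i j k)
    show ?thesis
    proof (cases "i < m \<and> j < m \<and> k \<in> {1..K}")
      case True
      then show ?thesis
        unfolding fields
        by (simp add: Y_def) (intro borel_measurable_times borel_measurable_const measurable_hat_rho assms(4), auto)
    next
      case False
      then show ?thesis
        unfolding fields by (auto simp: Y_def)
    qed
  qed
  have YU: "vanishes_in_prob (\<lambda>N \<omega>. Y N \<omega> p - U N \<omega> p)" "bounded_in_prob (\<lambda>N \<omega>. U N \<omega> p)" if "p \<in> D" for p
  proof -
    obtain i j k where "p = (i, j, k)" by (cases p)
    with that have p: "p = (i, j, k)" "i < m" "j < m" "k \<ge> 1" "k \<le> K"
      by (auto simp: mem_D)
    show "vanishes_in_prob (\<lambda>N \<omega>. Y N \<omega> p - U N \<omega> p)"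
      using hat_rho_standardize_approx[OF assms(4-6)[OF p(2)] assms(4-6)[OF p(3)] p(4)] p
      by (simp add: Y_def U_def a_def)
    show "bounded_in_prob (\<lambda>N \<omega>. U N \<omega> p)"
      using hat_gamma_approx(2)[OF a[OF p(2)] a[OF p(3)] p(4)] p by (simp add: U_def)
  qed
  have "conv_distr M Y \<nu>"
  proof (rule conv_distr_cramer_wold[OF \<open>finite D\<close> m_Y])
    show "Y N \<omega> p = 0" if "p \<notin> D" for N \<omega> p
      using that by (cases p) (auto simp: Y_def mem_D)
    show "prob_space \<nu>" unfolding \<nu>_def by (rule P.prob_space_distr) simp
    show "sets \<nu> = sets borel" by (simp add: \<nu>_def)
    show "AE x in \<nu>. \<forall>p. p \<notin> D \<longrightarrow> x p = 0"
      unfolding \<nu>_def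
    proof (subst AE_distr_iff)
      have "AE \<omega> in P. \<forall>p. p \<notin> I \<longrightarrow> Xi k \<omega> p = 0" for k
        unfolding P_def Xi_def using AE_PiM_component[of UNIV "\<lambda>_. \<mu>" k] \<mu>_prob \<mu>_support by auto
      then have "AE \<omega> in P. \<forall>k p. p \<notin> I \<longrightarrow> Xi k \<omega> p = 0"
        by (subst AE_all_countable) blast
      then show "AE \<omega> in P. \<forall>p. p \<notin> D \<longrightarrow> V \<omega> p = 0"
        by eventually_elim (auto simp: V_def mem_D I_def)
    qed (auto intro: sets_borel_support)
    show "bounded_in_prob (\<lambda>N \<omega>. Y N \<omega> p)" if "p \<in> D" for p
      using bounded_in_prob_add[OF vanishes_in_prob_bounded[OF YU(1)[OF that]] YU(2)[OF that]] by simp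
    fix t :: "nat \<times> nat \<times> nat \<Rightarrow> real"
    define v where "v = (\<Sum>k\<in>{1..K}. \<Sum>p\<in>I. \<Sum>q\<in>I. t (fst p, snd p, k) * S p q * t (fst q, snd q, k))"
    have m_U: "random_variable borel (\<lambda>\<omega>. U N \<omega> p)" if "p \<in> D" for N p
      using bounded_in_prob_measurable[OF YU(2)[OF that]] .
    have "vanishes_in_prob (\<lambda>N \<omega>. \<Sum>p\<in>D. t p * (Y N \<omega> p - U N \<omega> p))"
      by (intro vanishes_in_prob_sum vanishes_in_prob_cmult YU)
    then have "(\<lambda>N. (\<integral>\<omega>. cis (\<Sum>p\<in>D. t p * Y N \<omega> p) \<partial>M) - (\<integral>\<omega>. cis (\<Sum>p\<in>D. t p * U N \<omega> p) \<partial>M)) \<longlonglongrightarrow> 0"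
      using m_U by (intro cis_expectation_diff_tendsto_0) (auto simp: right_diff_distrib sum_subtractf)
    moreover have "(\<lambda>N. \<integral>\<omega>. cis (\<Sum>p\<in>D. t p * U N \<omega> p) \<partial>M) \<longlonglongrightarrow> complex_of_real (exp (- v / 2))"
    proof -
      \<comment> \<open>The covariance on triples: C (x) C on equal lags and 0 across lags. Hence
        the inner sum over \<open>D\<close> retains a single lag and the form reduces to
        \<open>v\<close>.\<close>
      define \<Gamma> where "\<Gamma> = (\<lambda>(p :: nat \<times> nat \<times> nat) q. if snd (snd p) = snd (snd q)
         then c (fst p) (fst q) * c (fst (snd p)) (fst (snd q)) else 0)"
      have "(\<lambda>N. \<integral>\<omega>. cis (\<Sum>p\<in>D. t p * U N \<omega> p) \<partial>M)
          \<longlonglongrightarrow> complex_of_real (exp (- (\<Sum>p\<in>D. \<Sum>q\<in>D. t p * \<Gamma> p q * t q) / 2))"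
        unfolding U_def \<Gamma>_def c
        by (rule lag_sums_clt[where K = K]) (auto simp: mem_D intro: a)
      also have "(\<Sum>p\<in>D. \<Sum>q\<in>D. t p * \<Gamma> p q * t q) = v"
      proof -
        have "(\<Sum>q\<in>D. t (fst p, snd p, k) * \<Gamma> (fst p, snd p, k) q * t q)
            = (\<Sum>q\<in>I. t (fst p, snd p, k) * S p q * t (fst q, snd q, k))" if "k \<in> {1..K}" for p k
        proof -
          have "(\<Sum>q\<in>D. t (fst p, snd p, k) * \<Gamma> (fst p, snd p, k) q * t q)
            = (\<Sum>l\<in>{1..K}. if k = l then \<Sum>q\<in>I. t (fst p, snd p, k) * S p q * t (fst q, snd q, k) else 0)"
            unfolding sum_D by (intro sum.cong refl) (auto simp: \<Gamma>_def S_def split_beta)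
          then show ?thesis using that by simp
        qed
        then show ?thesis unfolding v_def sum_D[of "\<lambda>p. \<Sum>q\<in>D. t p * \<Gamma> p q * t q"] by simp
      qed
      finally show ?thesis .
    qed
    ultimately have "(\<lambda>N. \<integral>\<omega>. cis (\<Sum>p\<in>D. t p * Y N \<omega> p) \<partial>M) \<longlonglongrightarrow> complex_of_real (exp (- v / 2))"
      using tendsto_add by fastforce
    moreover have "(\<integral>x. cis (\<Sum>p\<in>D. t p * x p) \<partial>\<nu>) = complex_of_real (exp (- v / 2))"
    proof -
      have "(\<lambda>x. cis (\<Sum>p\<in>D. t p * x p)) \<in> borel_measurable borel"
        unfolding cis_conv_exp by measurable
      then have "(\<integral>x. cis (\<Sum>p\<in>D. t p * x p) \<partial>\<nu>) = (\<integral>\<omega>. cis (\<Sum>p\<in>D. t p * V \<omega> p) \<partial>P)"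
        unfolding \<nu>_def by (subst integral_distr) auto
      also have "\<dots> = (\<integral>\<omega>. cis (\<Sum>k\<in>{1..K}. \<Sum>p\<in>I. t (fst p, snd p, k) * \<omega> k p) \<partial>P)"
        unfolding sum_D by (simp add: V_def Xi_def)
      also have "\<dots> = complex_of_real (exp (- v / 2))"
        unfolding P_def v_def by (rule iid_gaussian_char[OF \<mu>]) simp
      finally show ?thesis .
    qed
    ultimately show "(\<lambda>N. \<integral>\<omega>. cis (\<Sum>p\<in>D. t p * Y N \<omega> p) \<partial>M) \<longlonglongrightarrow> (\<integral>x. cis (\<Sum>p\<in>D. t p * x p) \<partial>\<nu>)"
      by simp
  qed
  then show ?thesis
    unfolding Y_def \<nu>_def V_def
    using P.prob_space_axioms P.indep_vars_subset[OF indep, of "{1..K}"] \<mu>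
    by (intro exI[of _ P] exI[of _ Xi] conjI ballI) (auto simp: distr_Xi I_def S_def c_def)
qed

end
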